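(* Let $(M,K,\nabla^K,C,S,\zeta,V,(v_1,\dots,v_n))$ be a Frobenius like structure of some order $(n,k,m)\in\mathbb{Z}_{>0}^3$. Then locally potentials of the first and second kind exist; that is, every $z\in M\subset\mathbb{C}^n$ has an open neighbourhood $W\subset M$ on which there exist a potential of the first kind $Q\in\mathcal{O}(W)$ and a potential of the second kind $L\in\mathcal{O}(W)$.
   Context: Let $z_1,\dots,z_n$ be the coordinates on $\mathbb{C}^n$ and $\partial_i=\partial/\partial z_i$ the coordinate vector fields. $\mathcal{O}_M$ denotes holomorphic functions on $M$, $\mathcal{T}_M$ holomorphic vector fields, $\Omega^1_M$ holomorphic 1-forms, $\mathcal{O}(K)$ holomorphic sections of $K$. Higgs field: for a holomorphic vector bundle $K\to M$ with flat connection $\nabla^K$, a Higgs field $C$ on $K$ is an $\mathcal{O}_M$-linear map $C:\mathcal{O}(K)\to\Omega^1_M\otimes\mathcal{O}(K)$ such that all the endomorphisms $C_X$, $X\in\mathcal{T}_M$, commute. The 2-form $\nabla^K(C)$ is defined by $\nabla^K(C)(X,Y)=\nabla^K_X(C_Y)-\nabla^K_Y(C_X)-C_{[X,Y]}$ for $X,Y\in\mathcal{T}_M$, where $\nabla^K_X(C_Y)=[\nabla^K_X,C_Y]$ is the induced derivative of the endomorphism $C_Y$; so $\nabla^K(C)=0$ means $\nabla^K_{\partial_i}(C_{\partial_j})=\nabla^K_{\partial_j}(C_{\partial_i})$ for all $i,j$. Frobenius like structure: a Frobenius like structure of order $(n,k,m)\in\mathbb{Z}_{>0}^3$ with $n\ge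 k$ is a tuple $(M,K,\nabla^K,C,S,\zeta,V,(v_1,\dots,v_n))$ with the following properties. $M$ is an open subset of $\mathbb{C}^n$; $K\to M$ is a holomorphic vector bundle on $M$ with (holomorphic) flat connection $\nabla^K$; $C$ is a Higgs field on $K$ with $\nabla^K(C)=0$; $S$ is a $\nabla^K$-flat ($\mathcal{O}_M$-)$m$-linear form $S:\mathcal{O}(K)^m\to\mathcal{O}_M$ which is Higgs field invariant, i.e. $S(C_Xs_1,s_2,\dots,s_m)=S(s_1,C_Xs_2,\dots,s_m)=\dots=S(s_1,s_2,\dots,C_Xs_m)$ for $s_1,\dots,s_m\in\mathcal{O}(K)$ and $X\in\mathcal{T}_M$; $\zeta$ is a global (holomorphic) section of $K$; $V$ is a $k$-dimensional $\mathbb{C}$-vector space; $(v_1,\dots,v_n)$ is a tuple of vectors in $V$ with $\langle v_1,\dots,v_n\rangle=V$; and, with $J:=\{1,\dots,n\}$, for any $\{i_1,\dots,i_k\}\subset J$ such that $(v_{i_1},\dots,v_{i_k})$ is a basis of $V$, the section $C_{\partial_{i_1}}\cdots C_{\partial_{i_k}}\zeta$ is $\nabla^K$-flat. ($S$ being $\nabla^K$-flat means $X\,S(s_1,\dots,s_m)=\sum_{j}S(s_1,\dots,\nabla^K_Xs_j,\dots,s_m)$.) A subset $I=\{i_1,\dots,i_k\}\subset J$ is called independent if $(v_{i_1},\dots,v_{i_k})$ is a basis of $V$. For such $I$ put $\partial_I:=\partial_{i_1}\cdots\partial_{i_k}$ and $C_I:=C_{\partial_{i_1}}\cdots C_{\partial_{i_k}}:\mathcal{O}(K)\to\mathcal{O}(K)$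 (both independent of the order of the elements). A potential of the first kind is a holomorphic function $Q$ with $\partial_{I_1}\cdots\partial_{I_m}Q=S(C_{I_1}\zeta,\dots,C_{I_m}\zeta)$ for any $m$ independent subsets $I_1,\dots,I_m\subset J$ (not necessarily distinct). A potential of the second kind is a holomorphic function $L$ with $\partial_i\partial_{I_1}\cdots\partial_{I_m}L=S(C_{\partial_i}C_{I_1}\zeta,C_{I_2}\zeta,\dots,C_{I_m}\zeta)$ for any $m$ independent subsets $I_1,\dots,I_m\subset J$ (not necessarily distinct) and any $i\in J$. *)

theory Defs
  imports "HOL-Analysis.Analysis"
begin

section \<open>Holomorphic functions and vector fields on open subsets of $\mathbb{C}^n$\<close>

text \<open>
  Complex differentiability at every point: the real Frechet derivative exists and is
  complex linear, with Jacobian row \<open>a\<close>. Only used for open \<open>W\<close>; the values of \<open>f\<close> outside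
  \<open>W\<close> are irrelevant.
\<close>
definition holo_on :: "(complex^'n::finite \<Rightarrow> complex) \<Rightarrow> (complex^'n) set \<Rightarrow> bool" where
  "holo_on f W \<longleftrightarrow>
     (\<forall>z\<in>W. \<exists>a :: complex^'n. (f has_derivative (\<lambda>h. \<Sum>i\<in>UNIV. a $ i * h $ i)) (at z))"

definition partial :: "'n::finite \<Rightarrow> (complex^'n \<Rightarrow> complex) \<Rightarrow> complex^'n \<Rightarrow> complex" where
  "partial i f z = deriv (\<lambda>t. f (z + axis i t)) 0"

definition partials :: "'n::finite list \<Rightarrow> (complex^'n \<Rightarrow> complex) \<Rightarrow> complex^'n \<Rightarrow> complex" where
  "partials js f = foldr partial js f"

text \<open>A vector field \<open>\<Sum>i. X\<^sub>i \<partial>\<^sub>i\<close> is represented by its coefficient vector.\<close>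
definition holo_vf :: "(complex^'n::finite \<Rightarrow> complex^'n) \<Rightarrow> (complex^'n) set \<Rightarrow> bool" where
  "holo_vf X W \<longleftrightarrow> (\<forall>i. holo_on (\<lambda>z. X z $ i) W)"

definition coord_vf :: "'n::finite \<Rightarrow> complex^'n \<Rightarrow> complex^'n" where
  "coord_vf i = (\<lambda>z. axis i 1)"

definition vf_apply ::
  "(complex^'n::finite \<Rightarrow> complex^'n) \<Rightarrow> (complex^'n \<Rightarrow> complex) \<Rightarrow> complex^'n \<Rightarrow> complex" where
  "vf_apply X f z = (\<Sum>i\<in>UNIV. X z $ i * partial i f z)"

definition lie_bracket ::
  "(complex^'n::finite \<Rightarrow> complex^'n) \<Rightarrow> (complex^'n \<Rightarrow> complex^'n) \<Rightarrow> complex^'n \<Rightarrow> complex^'n" where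
  "lie_bracket X Y z =
     (\<chi> j. vf_apply X (\<lambda>w. Y w $ j) z - vf_apply Y (\<lambda>w. X w $ j) z)"


section \<open>Holomorphic vector bundles and their sheaves of sections\<close>

text \<open>
  A local trivialisation \<open>(U, r, \<phi>)\<close> consists of an open set \<open>U\<close>, the rank \<open>r\<close> over \<open>U\<close>, and
  linear isomorphisms \<open>\<phi> z\<close> from the fibre over \<open>z\<close> to \<open>\<complex>\<^sup>r\<close>, for \<open>z \<in> U\<close>.
\<close>
type_synonym ('n, 'e) local_triv =
  "(complex^'n) set \<times> nat \<times> (complex^'n \<Rightarrow> 'e \<Rightarrow> nat \<Rightarrow> complex)"

definition cspace :: "nat \<Rightarrow> (nat \<Rightarrow> complex) set" where
  "cspace r = {x. \<forall>j\<ge>r. x j = 0}"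

definition unit_coord :: "nat \<Rightarrow> nat \<Rightarrow> complex" where
  "unit_coord i = (\<lambda>j. if j = i then 1 else 0)"

text \<open>
  The fibres \<open>E z\<close> are subspaces of a complex vector space with scalar multiplication
  \<open>scaleK\<close>. This space is purely algebraic and only serves to carry the fibres (for an
  abstract bundle take the direct sum of all fibres); the holomorphic structure comes from
  the trivialising atlas \<open>triv\<close> alone.
\<close>
locale holomorphic_vector_bundle = vector_space scaleK
  for scaleK :: "complex \<Rightarrow> 'e::ab_group_add \<Rightarrow> 'e" +
  fixes M :: "(complex^'n::finite) set"
    and E :: "complex^'n \<Rightarrow> 'e set"
    and triv :: "('n, 'e) local_triv set"
  assumes open_base: "open M"
    and fibre_subspace: "\<And>z. z \<in> M \<Longrightarrow> subspace (E z)"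
    and triv_domain: "\<And>U r \<phi>. (U, r, \<phi>) \<in> triv \<Longrightarrow> open U \<and> U \<subseteq> M"
    and triv_cover: "\<And>z. z \<in> M \<Longrightarrow> \<exists>(U, r, \<phi>)\<in>triv. z \<in> U"
    and triv_add: "\<And>U r \<phi> z a b j. (U, r, \<phi>) \<in> triv \<Longrightarrow> z \<in> U \<Longrightarrow> a \<in> E z \<Longrightarrow> b \<in> E z \<Longrightarrow>
          \<phi> z (a + b) j = \<phi> z a j + \<phi> z b j"
    and triv_scale: "\<And>U r \<phi> z c a j. (U, r, \<phi>) \<in> triv \<Longrightarrow> z \<in> U \<Longrightarrow> a \<in> E z \<Longrightarrow>
          \<phi> z (scaleK c a) j = c * \<phi> z a j"
    and triv_bij: "\<And>U r \<phi> z. (U, r, \<phi>) \<in> triv \<Longrightarrow> z \<in> U \<Longrightarrow> bij_betw (\<phi> z) (E z) (cspace r)"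
    and triv_transition: "\<And>U r \<phi> U' r' \<phi>' i j. (U, r, \<phi>) \<in> triv \<Longrightarrow> (U', r', \<phi>') \<in> triv \<Longrightarrow>
          i < r \<Longrightarrow> j < r' \<Longrightarrow>
          holo_on (\<lambda>z. \<phi>' z (inv_into (E z) (\<phi> z) (unit_coord i)) j) (U \<inter> U')"

text \<open>
  Holomorphic sections over an open set \<open>W\<close>. Sections are total functions of which only the
  values on \<open>W\<close> matter.
\<close>
definition sections :: "(complex^'n::finite \<Rightarrow> 'e set) \<Rightarrow> ('n, 'e) local_triv set \<Rightarrow>
    (complex^'n) set \<Rightarrow> (complex^'n \<Rightarrow> 'e) set" where
  "sections E triv W =
     {s. (\<forall>z\<in>W. s z \<in> E z) \<and>
         (\<forall>(U, r, \<phi>)\<in>triv. \<forall>j<r. holo_on (\<lambda>z. \<phi> z (s z) j) (U \<inter> W))}"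

text \<open>
  A map of sheaves \<open>A : \<O>(K) \<rightarrow> \<Omega>\<^sup>1\<^sub>M \<otimes> \<O>(K)\<close> (additive, but not necessarily
  \<open>\<O>\<^sub>M\<close>-linear) is given by the sections \<open>A U X s\<close> over \<open>U\<close>, for each open \<open>U \<subseteq> M\<close>, each
  holomorphic vector field \<open>X\<close> on \<open>U\<close> and each section \<open>s\<close> over \<open>U\<close>. It is
  \<open>\<O>\<^sub>M\<close>-linear in \<open>X\<close>. The condition \<open>op_restrict\<close> says both that the maps commute with
  restriction and that \<open>A U X s\<close> does not depend on the values of \<open>X\<close> and \<open>s\<close> outside \<open>U\<close>.
\<close>
type_synonym ('n, 'e) section_op = "(complex^'n) set \<Rightarrow> (complex^'n \<Rightarrow> complex^'n) \<Rightarrow>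
    (complex^'n \<Rightarrow> 'e) \<Rightarrow> complex^'n \<Rightarrow> 'e"

locale one_form_valued_op = holomorphic_vector_bundle scaleK M E triv
  for scaleK :: "complex \<Rightarrow> 'e::ab_group_add \<Rightarrow> 'e"
    and M :: "(complex^'n::finite) set"
    and E and triv +
  fixes A :: "('n, 'e) section_op"
  assumes op_section: "\<And>U X s. open U \<Longrightarrow> U \<subseteq> M \<Longrightarrow> holo_vf X U \<Longrightarrow> s \<in> sections E triv U \<Longrightarrow>
          A U X s \<in> sections E triv U"
    and op_restrict: "\<And>U W X X' s s' z. open U \<Longrightarrow> U \<subseteq> M \<Longrightarrow> open W \<Longrightarrow> W \<subseteq> U \<Longrightarrow>
          holo_vf X U \<Longrightarrow> holo_vf X' W \<Longrightarrow> s \<in> sections E triv U \<Longrightarrow> s' \<in> sections E triv W \<Longrightarrow>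
          \<forall>w\<in>W. X w = X' w \<Longrightarrow> \<forall>w\<in>W. s w = s' w \<Longrightarrow> z \<in> W \<Longrightarrow>
          A U X s z = A W X' s' z"
    and op_vf_add: "\<And>U X Y s z. open U \<Longrightarrow> U \<subseteq> M \<Longrightarrow> holo_vf X U \<Longrightarrow> holo_vf Y U \<Longrightarrow>
          s \<in> sections E triv U \<Longrightarrow> z \<in> U \<Longrightarrow>
          A U (\<lambda>w. X w + Y w) s z = A U X s z + A U Y s z"
    and op_vf_scale: "\<And>U f X s z. open U \<Longrightarrow> U \<subseteq> M \<Longrightarrow> holo_on f U \<Longrightarrow> holo_vf X U \<Longrightarrow>
          s \<in> sections E triv U \<Longrightarrow> z \<in> U \<Longrightarrow>
          A U (\<lambda>w. f w *s X w) s z = scaleK (f z) (A U X s z)"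
    and op_add: "\<And>U X s t z. open U \<Longrightarrow> U \<subseteq> M \<Longrightarrow> holo_vf X U \<Longrightarrow>
          s \<in> sections E triv U \<Longrightarrow> t \<in> sections E triv U \<Longrightarrow> z \<in> U \<Longrightarrow>
          A U X (\<lambda>w. s w + t w) z = A U X s z + A U X t z"

locale flat_connection = one_form_valued_op scaleK M E triv nabla
  for scaleK :: "complex \<Rightarrow> 'e::ab_group_add \<Rightarrow> 'e"
    and M :: "(complex^'n::finite) set"
    and E and triv
    and nabla :: "('n, 'e) section_op" +
  assumes leibniz: "\<And>U X f s z. open U \<Longrightarrow> U \<subseteq> M \<Longrightarrow> holo_vf X U \<Longrightarrow> holo_on f U \<Longrightarrow>
          s \<in> sections E triv U \<Longrightarrow> z \<in> U \<Longrightarrow>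
          nabla U X (\<lambda>w. scaleK (f w) (s w)) z =
            scaleK (vf_apply X f z) (s z) + scaleK (f z) (nabla U X s z)"
    and curvature_zero: "\<And>U X Y s z. open U \<Longrightarrow> U \<subseteq> M \<Longrightarrow> holo_vf X U \<Longrightarrow> holo_vf Y U \<Longrightarrow>
          s \<in> sections E triv U \<Longrightarrow> z \<in> U \<Longrightarrow>
          nabla U X (nabla U Y s) z - nabla U Y (nabla U X s) z
            - nabla U (lie_bracket X Y) s z = 0"

locale higgs_field = one_form_valued_op scaleK M E triv C
  for scaleK :: "complex \<Rightarrow> 'e::ab_group_add \<Rightarrow> 'e"
    and M :: "(complex^'n::finite) set"
    and E and triv
    and C :: "('n, 'e) section_op" +
  assumes higgs_scale: "\<And>U X f s z. open U \<Longrightarrow> U \<subseteq> M \<Longrightarrow> holo_vf X U \<Longrightarrow> holo_on f U \<Longrightarrow>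
          s \<in> sections E triv U \<Longrightarrow> z \<in> U \<Longrightarrow>
          C U X (\<lambda>w. scaleK (f w) (s w)) z = scaleK (f z) (C U X s z)"
    and higgs_commute: "\<And>U X Y s z. open U \<Longrightarrow> U \<subseteq> M \<Longrightarrow> holo_vf X U \<Longrightarrow> holo_vf Y U \<Longrightarrow>
          s \<in> sections E triv U \<Longrightarrow> z \<in> U \<Longrightarrow>
          C U X (C U Y s) z = C U Y (C U X s) z"

text \<open>The derivative \<open>[\<nabla>\<^sub>X, A]\<close> of an endomorphism \<open>A\<close> of the sections over \<open>U\<close>.\<close>
definition end_deriv :: "('n::finite, 'e::ab_group_add) section_op \<Rightarrow> (complex^'n) set \<Rightarrow>
    (complex^'n \<Rightarrow> complex^'n) \<Rightarrow> ((complex^'n \<Rightarrow> 'e) \<Rightarrow> complex^'n \<Rightarrow> 'e) \<Rightarrow>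
    (complex^'n \<Rightarrow> 'e) \<Rightarrow> complex^'n \<Rightarrow> 'e" where
  "end_deriv nabla U X A s z = nabla U X (A s) z - A (nabla U X s) z"

definition nabla_higgs :: "('n::finite, 'e::ab_group_add) section_op \<Rightarrow> ('n, 'e) section_op \<Rightarrow>
    (complex^'n) set \<Rightarrow> (complex^'n \<Rightarrow> complex^'n) \<Rightarrow> (complex^'n \<Rightarrow> complex^'n) \<Rightarrow>
    (complex^'n \<Rightarrow> 'e) \<Rightarrow> complex^'n \<Rightarrow> 'e" where
  "nabla_higgs nabla C U X Y s z =
     end_deriv nabla U X (C U Y) s z - end_deriv nabla U Y (C U X) s z
       - C U (lie_bracket X Y) s z"

definition flat_section :: "('n::finite, 'e::ab_group_add) section_op \<Rightarrow> (complex^'n) set \<Rightarrow>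
    (complex^'n \<Rightarrow> 'e) \<Rightarrow> bool" where
  "flat_section nabla W s \<longleftrightarrow>
     (\<forall>U X. open U \<and> U \<subseteq> W \<and> holo_vf X U \<longrightarrow> (\<forall>z\<in>U. nabla U X s z = 0))"

text \<open>
  \<open>\<O>\<^sub>M\<close>-multilinear maps of sheaves \<open>\<O>(K)\<^sup>m \<rightarrow> \<O>\<^sub>M\<close>; an \<open>m\<close>-tuple of sections over \<open>U\<close> is
  a list of length \<open>m\<close>.
\<close>
locale multilinear_form = holomorphic_vector_bundle scaleK M E triv
  for scaleK :: "complex \<Rightarrow> 'e::ab_group_add \<Rightarrow> 'e"
    and M :: "(complex^'n::finite) set"
    and E and triv +
  fixes m :: nat
    and S :: "(complex^'n) set \<Rightarrow> (complex^'n \<Rightarrow> 'e) list \<Rightarrow> complex^'n \<Rightarrow> complex"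
  assumes form_holo: "\<And>U ss. open U \<Longrightarrow> U \<subseteq> M \<Longrightarrow> length ss = m \<Longrightarrow>
          set ss \<subseteq> sections E triv U \<Longrightarrow> holo_on (S U ss) U"
    and form_restrict: "\<And>U W ss ss' z. open U \<Longrightarrow> U \<subseteq> M \<Longrightarrow> open W \<Longrightarrow> W \<subseteq> U \<Longrightarrow>
          length ss = m \<Longrightarrow> length ss' = m \<Longrightarrow>
          set ss \<subseteq> sections E triv U \<Longrightarrow> set ss' \<subseteq> sections E triv W \<Longrightarrow>
          \<forall>j<m. \<forall>w\<in>W. (ss ! j) w = (ss' ! j) w \<Longrightarrow> z \<in> W \<Longrightarrow> S U ss z = S W ss' z"
    and form_add: "\<And>U ss j s t z. open U \<Longrightarrow> U \<subseteq> M \<Longrightarrow> length ss = m \<Longrightarrow>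
          set ss \<subseteq> sections E triv U \<Longrightarrow> j < m \<Longrightarrow>
          s \<in> sections E triv U \<Longrightarrow> t \<in> sections E triv U \<Longrightarrow> z \<in> U \<Longrightarrow>
          S U (ss[j := (\<lambda>w. s w + t w)]) z = S U (ss[j := s]) z + S U (ss[j := t]) z"
    and form_scale: "\<And>U ss j f s z. open U \<Longrightarrow> U \<subseteq> M \<Longrightarrow> length ss = m \<Longrightarrow>
          set ss \<subseteq> sections E triv U \<Longrightarrow> j < m \<Longrightarrow> holo_on f U \<Longrightarrow>
          s \<in> sections E triv U \<Longrightarrow> z \<in> U \<Longrightarrow>
          S U (ss[j := (\<lambda>w. scaleK (f w) (s w))]) z = f z * S U (ss[j := s]) z"


section \<open>Frobenius like structures and their potentials\<close>

text \<open>
  \<open>V\<close> is a subspace of an arbitrary complex vector space with scalar multiplication \<open>scaleV\<close>.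
  The condition says that the family \<open>(v i)\<close> indexed by \<open>i \<in> I\<close> is a basis of \<open>V\<close>.
\<close>
definition independent_subset :: "(complex \<Rightarrow> 'v::ab_group_add \<Rightarrow> 'v) \<Rightarrow> 'v set \<Rightarrow>
    ('n \<Rightarrow> 'v) \<Rightarrow> 'n set \<Rightarrow> bool" where
  "independent_subset scaleV V v I \<longleftrightarrow>
     inj_on v I \<and> \<not> module.dependent scaleV (v ` I) \<and> module.span scaleV (v ` I) = V"

text \<open>
  \<open>\<partial>\<^sub>I\<close> and \<open>C\<^sub>I\<close> do not depend on the order of the elements of \<open>I\<close>. Below, an independent
  subset \<open>I\<close> is given by a list enumerating it without repetitions, and the conditions are
  required for all such enumerations.
\<close>
definition independent_list :: "(complex \<Rightarrow> 'v::ab_group_add \<Rightarrow> 'v) \<Rightarrow> 'v set \<Rightarrow>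
    ('n \<Rightarrow> 'v) \<Rightarrow> 'n list \<Rightarrow> bool" where
  "independent_list scaleV V v is \<longleftrightarrow> distinct is \<and> independent_subset scaleV V v (set is)"

definition higgs_list :: "('n::finite, 'e) section_op \<Rightarrow> (complex^'n) set \<Rightarrow> 'n list \<Rightarrow>
    (complex^'n \<Rightarrow> 'e) \<Rightarrow> complex^'n \<Rightarrow> 'e" where
  "higgs_list C U is s = foldr (\<lambda>i. C U (coord_vf i)) is s"

text \<open>
  A Frobenius like structure of order \<open>(CARD('n), k, m)\<close>; the index set \<open>J\<close> is the type \<open>'n\<close>.
\<close>
locale frobenius_like_structure =
  conn: flat_connection scaleK M E triv nabla +
  higgs: higgs_field scaleK M E triv C +
  form: multilinear_form scaleK M E triv m S +
  V: vector_space scaleV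
  for k m :: nat
    and M :: "(complex^'n::finite) set"
    and scaleK :: "complex \<Rightarrow> 'e::ab_group_add \<Rightarrow> 'e"
    and E and triv and nabla and C and S
    and \<zeta> :: "complex^'n \<Rightarrow> 'e"
    and scaleV :: "complex \<Rightarrow> 'v::ab_group_add \<Rightarrow> 'v"
    and V :: "'v set"
    and v :: "'n \<Rightarrow> 'v" +
  assumes k_pos: "k > 0" and m_pos: "m > 0" and k_le_n: "k \<le> CARD('n)"
    and higgs_potential: "\<And>U X Y s z. open U \<Longrightarrow> U \<subseteq> M \<Longrightarrow> holo_vf X U \<Longrightarrow> holo_vf Y U \<Longrightarrow>
          s \<in> sections E triv U \<Longrightarrow> z \<in> U \<Longrightarrow> nabla_higgs nabla C U X Y s z = 0"
    and form_flat: "\<And>U X ss z. open U \<Longrightarrow> U \<subseteq> M \<Longrightarrow> holo_vf X U \<Longrightarrow> length ss = m \<Longrightarrow>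
          set ss \<subseteq> sections E triv U \<Longrightarrow> z \<in> U \<Longrightarrow>
          vf_apply X (S U ss) z = (\<Sum>j<m. S U (ss[j := nabla U X (ss ! j)]) z)"
    and form_higgs_invariant: "\<And>U X ss i j z. open U \<Longrightarrow> U \<subseteq> M \<Longrightarrow> holo_vf X U \<Longrightarrow>
          length ss = m \<Longrightarrow> set ss \<subseteq> sections E triv U \<Longrightarrow> i < m \<Longrightarrow> j < m \<Longrightarrow> z \<in> U \<Longrightarrow>
          S U (ss[i := C U X (ss ! i)]) z = S U (ss[j := C U X (ss ! j)]) z"
    and zeta_section: "\<zeta> \<in> sections E triv M"
    and V_subspace: "V.subspace V"
    and V_dim: "V.dim V = k"
    and v_span: "V.span (range v) = V"
    and higgs_zeta_flat: "\<And>is. independent_list scaleV V v is \<Longrightarrow>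
          flat_section nabla M (higgs_list C M is \<zeta>)"

definition potential_first_kind :: "nat \<Rightarrow> ('n::finite, 'e) section_op \<Rightarrow>
    ((complex^'n) set \<Rightarrow> (complex^'n \<Rightarrow> 'e) list \<Rightarrow> complex^'n \<Rightarrow> complex) \<Rightarrow>
    (complex^'n \<Rightarrow> 'e) \<Rightarrow> (complex \<Rightarrow> 'v::ab_group_add \<Rightarrow> 'v) \<Rightarrow> 'v set \<Rightarrow> ('n \<Rightarrow> 'v) \<Rightarrow>
    (complex^'n) set \<Rightarrow> (complex^'n \<Rightarrow> complex) \<Rightarrow> bool" where
  "potential_first_kind m C S \<zeta> scaleV V v W Q \<longleftrightarrow>
     holo_on Q W \<and>
     (\<forall>Is. length Is = m \<and> (\<forall>I\<in>set Is. independent_list scaleV V v I) \<longrightarrow>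
        (\<forall>z\<in>W. partials (concat Is) Q z = S W (map (\<lambda>I. higgs_list C W I \<zeta>) Is) z))"

definition potential_second_kind :: "nat \<Rightarrow> ('n::finite, 'e) section_op \<Rightarrow>
    ((complex^'n) set \<Rightarrow> (complex^'n \<Rightarrow> 'e) list \<Rightarrow> complex^'n \<Rightarrow> complex) \<Rightarrow>
    (complex^'n \<Rightarrow> 'e) \<Rightarrow> (complex \<Rightarrow> 'v::ab_group_add \<Rightarrow> 'v) \<Rightarrow> 'v set \<Rightarrow> ('n \<Rightarrow> 'v) \<Rightarrow>
    (complex^'n) set \<Rightarrow> (complex^'n \<Rightarrow> complex) \<Rightarrow> bool" where
  "potential_second_kind m C S \<zeta> scaleV V v W L \<longleftrightarrow>
     holo_on L W \<and>
     (\<forall>i I Is. length (I # Is) = m \<and> (\<forall>I'\<in>set (I # Is). independent_list scaleV V v I') \<longrightarrow>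
        (\<forall>z\<in>W. partials (i # concat (I # Is)) L z =
           S W (C W (coord_vf i) (higgs_list C W I \<zeta>) # map (\<lambda>I'. higgs_list C W I' \<zeta>) Is) z))"

end

theory Submission
  imports Defs "HOL-Complex_Analysis.Cauchy_Integral_Formula" "HOL-Library.Function_Algebras"
    "HOL-Library.Multiset"
begin

text \<open>
  The sections \<open>C\<^sub>I \<zeta>\<close> and the form \<open>S\<close> are flat, so the derivatives prescribed for \<open>Q\<close> are
  constants, and by Higgs field invariance the derivatives prescribed for \<open>Q\<close> and \<open>L\<close> depend only
  on the multiset of all indices. Thus \<open>\<partial>\<^sup>U L = f U\<close> has to be solved for finitely many
  multisets \<open>U\<close>. On a ball this is done one equation at a time: with \<open>J\<^sub>i\<close> integration in
  direction \<open>i\<close> from the central hyperplane, replace \<open>L\<close> by \<open>L + J\<^sup>U (f U - \<partial>\<^sup>U L)\<close>. This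
  preserves the equation for \<open>U'\<close> as soon as the derivative of \<open>f U\<close> along \<open>U' - U\<close> equals that of
  \<open>f U'\<close> along \<open>U - U'\<close>. For \<open>Q\<close> both sides vanish unless \<open>U = U'\<close>. For \<open>L\<close> the multisets are
  \<open>T + i\<close> with \<open>T\<close> a sum of \<open>m\<close> bases; \<open>\<nabla>(C) = 0\<close> gives \<open>\<partial>\<^sub>j (f (T + i)) = \<partial>\<^sub>i (f (T + j))\<close>, and
  basis exchange joins any two such \<open>T\<close>.
\<close>

section \<open>Partial derivatives and primitives of holomorphic functions\<close>

lemma bounded_linear_axis: "bounded_linear (axis i :: complex \<Rightarrow> complex^'n)"
  unfolding linear_conv_bounded_linear[symmetric]
  by (rule linearI) (simp_all add: axis_def vec_eq_iff)

lemma has_derivative_axis_shift: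
  fixes z :: "complex^'n"
  shows "((\<lambda>t. z + axis i t) has_derivative axis i) (at t within S)"
  using has_derivative_add[OF has_derivative_const bounded_linear_imp_has_derivative[OF bounded_linear_axis]]
  by simp

lemma axis_zero [simp]: "axis i (0::complex) = (0 :: complex^'n)"
  by (simp add: axis_def vec_eq_iff)

lemma axis_add: "axis i (a + b) = axis i a + (axis i b :: complex^'n)"
  by (simp add: axis_def vec_eq_iff)

lemma sum_axis: "(\<Sum>j\<in>UNIV. a j * (axis i t :: complex^'n) $ j) = a i * t"
  by (simp add: axis_def if_distrib[of "\<lambda>x. _ * x"] cong: if_cong)

lemma holo_onI:
  assumes "\<And>z. z \<in> W \<Longrightarrow> (f has_derivative (\<lambda>h. \<Sum>i\<in>UNIV. a z i * h $ i)) (at z)"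
  shows "holo_on f W"
  unfolding holo_on_def
proof
  fix z assume "z \<in> W"
  from assms[OF this] show "\<exists>b. (f has_derivative (\<lambda>h. \<Sum>i\<in>UNIV. b $ i * h $ i)) (at z)"
    by (intro exI[of _ "\<chi> i. a z i"]) simp
qed

text \<open>The chain rule along the line \<open>\<lambda>t. z + axis i t\<close> singles out the
  \<open>i\<close>-th entry of the Jacobian row. This connects \<open>partial\<close>, defined
  through \<open>deriv\<close>, with the row whose existence \<open>holo_on\<close> asserts.\<close>

lemma has_derivative_partial_unique:
  fixes z :: "complex^'n"
  assumes "(f has_derivative (\<lambda>h. \<Sum>i\<in>UNIV. a i * h $ i)) (at z)"
  shows "((\<lambda>t. f (z + axis i t)) has_field_derivative a i) (at 0)" "partial i f z = a i"
proof -
  have "(f has_derivative (\<lambda>h. \<Sum>i\<in>UNIV. a i * h $ i)) (at (z + axis i 0))"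
    using assms by simp
  from diff_chain_at[OF has_derivative_axis_shift this]
  have "((\<lambda>t. f (z + axis i t)) has_derivative (\<lambda>t. \<Sum>j\<in>UNIV. a j * axis i t $ j)) (at 0)"
    by (simp add: o_def)
  then show *: "((\<lambda>t. f (z + axis i t)) has_field_derivative a i) (at 0)"
    by (simp add: has_field_derivative_def sum_axis mult_commute_abs)
  show "partial i f z = a i"
    unfolding partial_def by (rule DERIV_imp_deriv[OF *])
qed

lemma holo_on_has_derivative:
  assumes "holo_on f W" "z \<in> W"
  shows "(f has_derivative (\<lambda>h. \<Sum>i\<in>UNIV. partial i f z * h $ i)) (at z)"
proof -
  from assms obtain a where a: "(f has_derivative (\<lambda>h. \<Sum>i\<in>UNIV. a $ i * h $ i)) (at z)"
    unfolding holo_on_def by blast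
  from has_derivative_partial_unique(2)[OF a] a show ?thesis by simp
qed

lemma holo_on_subset: "holo_on f W \<Longrightarrow> U \<subseteq> W \<Longrightarrow> holo_on f U"
  by (auto simp: holo_on_def)

lemma partial_cong:
  assumes "open W" "z \<in> W" "\<And>w. w \<in> W \<Longrightarrow> f w = g w"
  shows "partial i f z = partial i g z"
proof -
  have "isCont (\<lambda>t. z + axis i t) 0"
    by (rule has_derivative_continuous[OF has_derivative_axis_shift])
  then have "((\<lambda>t. z + axis i t) \<longlongrightarrow> z) (nhds 0)"
    using tendsto_at_iff_tendsto_nhds[of "\<lambda>t. z + axis i t" 0] by (simp add: isCont_def)
  then have "eventually (\<lambda>t. z + axis i t \<in> W) (nhds 0)"
    using assms by (simp add: topological_tendstoD)
  then have "eventually (\<lambda>t. f (z + axis i t) = g (z + axis i t)) (nhds 0)"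
    by eventually_elim (rule assms)
  then show ?thesis
    unfolding partial_def by (rule deriv_cong_ev) simp
qed

lemma holo_on_cong:
  assumes "open W" "\<And>w. w \<in> W \<Longrightarrow> f w = g w" "holo_on f W"
  shows "holo_on g W"
proof (rule holo_onI)
  fix z assume "z \<in> W"
  show "(g has_derivative (\<lambda>h. \<Sum>i\<in>UNIV. partial i f z * h $ i)) (at z)"
    using has_derivative_transform_within_open[OF holo_on_has_derivative[OF assms(3) \<open>z \<in> W\<close>] assms(1) \<open>z \<in> W\<close> assms(2)] .
qed

lemma holo_on_continuous_on: "holo_on f W \<Longrightarrow> continuous_on W f"
  by (meson continuous_at_imp_continuous_on has_derivative_continuous holo_on_has_derivative)

lemma has_field_derivative_along_axis:
  fixes z :: "complex^'n"
  assumes "holo_on f W" "z + axis i u \<in> W"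
  shows "((\<lambda>u. f (z + axis i u)) has_field_derivative partial i f (z + axis i u)) (at u)"
proof -
  have "((\<lambda>t. f ((z + axis i u) + axis i t)) has_field_derivative partial i f (z + axis i u)) (at 0)"
    by (rule has_derivative_partial_unique(1)[OF holo_on_has_derivative[OF assms]])
  then have "((\<lambda>t. f (z + axis i (t + u))) has_field_derivative partial i f (z + axis i u)) (at 0)"
    by (simp add: add.assoc axis_add add.commute[of _ u])
  then show ?thesis
    using DERIV_at_within_shift[of "\<lambda>u. f (z + axis i u)" "partial i f (z + axis i u)" u 0 UNIV]
    by (simp add: add.commute)
qed

section \<open>Cauchy's formula along a coordinate line and regularity of partial
  derivatives\<close>

text \<open>Cauchy's formula for the first derivative at 0 of \<open>f\<close> restricted to a
  coordinate line. Writing \<open>partial i f\<close> as an integral of \<open>f\<close> itself lets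
  it inherit continuity and differentiability.\<close>

lemma Cauchy_partial:
  fixes z :: "complex^'n"
  assumes "holo_on f W" "\<rho> > 0" "\<And>u. cmod u \<le> \<rho> \<Longrightarrow> z + axis i u \<in> W"
  shows "partial i f z =
    integral {0..1} (\<lambda>t. inverse (circlepath 0 \<rho> t) * f (z + axis i (circlepath 0 \<rho> t)))"
proof -
  define \<phi> where "\<phi> u = f (z + axis i u)" for u
  have d: "(\<phi> has_field_derivative partial i f (z + axis i u)) (at u)" if "cmod u \<le> \<rho>" for u
    unfolding \<phi>_def by (rule has_field_derivative_along_axis[OF assms(1) assms(3)[OF that]])
  have 1: "continuous_on (cball 0 \<rho>) \<phi>"
    by (rule continuous_at_imp_continuous_on) (auto intro!: DERIV_isCont[OF d])
  have 2: "\<phi> holomorphic_on ball 0 \<rho>"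
    unfolding holomorphic_on_def field_differentiable_def
  proof
    fix u :: complex assume "u \<in> ball 0 \<rho>"
    then have "(\<phi> has_field_derivative partial i f (z + axis i u)) (at u)" by (intro d) simp
    then show "\<exists>f'. (\<phi> has_field_derivative f') (at u within ball 0 \<rho>)"
      by (blast intro: has_field_derivative_at_within)
  qed
  have "((\<lambda>u. \<phi> u / (u-0) ^ (Suc 1)) has_contour_integral ((2 * pi * \<i>) / (fact 1) * (deriv ^^ 1) \<phi> 0))
           (circlepath 0 \<rho>)"
    by (rule Cauchy_has_contour_integral_higher_derivative_circlepath[OF 1 2]) (use assms(2) in auto)
  then have "((\<lambda>x. \<phi> (circlepath 0 \<rho> x) / (circlepath 0 \<rho> x)^2 * vector_derivative (circlepath 0 \<rho>) (at x within {0..1}))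
       has_integral (2 * pi * \<i>) * deriv \<phi> 0) {0..1}"
    by (simp add: has_contour_integral_def power2_eq_square)
  then have I: "((\<lambda>x. inverse (2 * pi * \<i>) * (\<phi> (circlepath 0 \<rho> x) / (circlepath 0 \<rho> x)^2 * vector_derivative (circlepath 0 \<rho>) (at x within {0..1})))
       has_integral inverse (2 * pi * \<i>) * ((2 * pi * \<i>) * deriv \<phi> 0)) {0..1}"
    by (rule has_integral_mult_right)
  have v: "inverse (2 * pi * \<i>) * ((2 * pi * \<i>) * deriv \<phi> 0) = partial i f z"
    using left_inverse[of "2 * pi * \<i>"] by (simp only: mult.assoc[symmetric]) (simp add: partial_def \<phi>_def[abs_def])
  \<comment> \<open>For a circle around 0 the velocity is \<open>2 * pi * \<i>\<close> times the
    position. This cancels the constant in Cauchy's formula and one of the two factors in the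
    denominator.\<close>
  have k: "inverse (2 * pi * \<i>) * (\<phi> (circlepath 0 \<rho> t) / (circlepath 0 \<rho> t)^2
      * vector_derivative (circlepath 0 \<rho>) (at t within {0..1}))
      = inverse (circlepath 0 \<rho> t) * \<phi> (circlepath 0 \<rho> t)" if "t \<in> {0..1}" for t
  proof -
    have v: "vector_derivative (circlepath 0 \<rho>) (at t within {0..1}) = 2 * pi * \<i> * circlepath 0 \<rho> t"
      using that by (subst vector_derivative_circlepath01) (auto simp: circlepath)
    have "circlepath 0 \<rho> t \<noteq> 0"
      using assms(2) by (simp add: circlepath)
    then show ?thesis
      by (simp add: v power2_eq_square field_simps)
  qed
  from has_integral_eq[OF k I]
  have "((\<lambda>t. inverse (circlepath 0 \<rho> t) * \<phi> (circlepath 0 \<rho> t)) has_integral partial i f z) {0..1}"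
    unfolding v .
  then show ?thesis by (simp add: \<phi>_def integral_unique)
qed

lemma continuous_on_axis [continuous_intros]:
  "continuous_on S g \<Longrightarrow> continuous_on S (\<lambda>x. axis i (g x :: complex) :: complex^'n)"
  by (rule bounded_linear.continuous_on[OF bounded_linear_axis])

lemma norm_axis: "norm (axis i u :: complex^'n) = cmod u"
  by (simp add: norm_eq_sqrt_inner inner_axis_axis)

lemma bounded_linear_row: "bounded_linear (\<lambda>h :: complex^'n. \<Sum>j\<in>UNIV. a j * h $ j)"
  by (intro bounded_linear_sum bounded_linear_const_mult bounded_linear_vec_nth)

text \<open>Differentiation under the integral sign. The shift may depend affinely on
  \<open>z $ i\<close>, so that one statement serves two purposes: \<open>c = 0\<close> with a
  circle \<open>d\<close> for Cauchy's formula, and \<open>c t = t - 1\<close> for primitives in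
  direction \<open>i\<close>.\<close>

lemma has_derivative_integral_shift:
  fixes W U :: "(complex^'n) set" and c d k :: "real \<Rightarrow> complex"
  assumes f: "holo_on f W" "\<And>j. continuous_on W (partial j f)"
    and U: "open U" "convex U" "z \<in> U"
    and cont: "continuous_on {0..1} c" "continuous_on {0..1} d" "continuous_on {0..1} k"
    and W: "\<And>z t. z \<in> U \<Longrightarrow> t \<in> {0..1} \<Longrightarrow> z + axis i (c t * z $ i + d t) \<in> W"
  shows "((\<lambda>z. integral {0..1} (\<lambda>t. k t * f (z + axis i (c t * z $ i + d t)))) has_derivative
    (\<lambda>h. \<Sum>j\<in>UNIV. integral {0..1} (\<lambda>t. (if j = i then 1 + c t else 1) * k t
        * partial j f (z + axis i (c t * z $ i + d t))) * h $ j)) (at z)"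
proof -
  define g where "g z t = z + axis i (c t * z $ i + d t)" for z t
  \<comment> \<open>Varying \<open>z\<close> by \<open>h\<close> also varies the shift by
    \<open>c t * h $ i\<close>; this is the extra \<open>c t\<close> in the weight of direction
    \<open>i\<close>.\<close>
  define w where "w j t = (if j = i then 1 + c t else 1) * k t" for j t
  \<comment> \<open>The derivative of the integrand as a bounded linear operator, the form in which
    \<open>leibniz_rule\<close> integrates it.\<close>
  define A where "A x t = Blinfun (\<lambda>h. \<Sum>j\<in>UNIV. w j t * partial j f (g x t) * h $ j)" for x t
  have A: "blinfun_apply (A x t) = (\<lambda>h. \<Sum>j\<in>UNIV. w j t * partial j f (g x t) * h $ j)" for x t
    unfolding A_def by (rule bounded_linear_Blinfun_apply[OF bounded_linear_row])
  have gW: "g x t \<in> W" if "x \<in> U" "t \<in> {0..1}" for x t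
    using W[OF that] by (simp add: g_def)
  have dg: "((\<lambda>x. g x t) has_derivative (\<lambda>h. h + axis i (c t * h $ i))) (at x)" for x t
    unfolding g_def
    by (auto intro!: derivative_eq_intros bounded_linear.has_derivative[OF bounded_linear_axis]
        bounded_linear.has_derivative[OF bounded_linear_vec_nth])
  have "((\<lambda>x. k t * f (g x t)) has_derivative A x t) (at x within U)"
    if "x \<in> U" "t \<in> cbox 0 1" for x t
  proof -
    have "((\<lambda>x. k t * f (g x t)) has_derivative
        (\<lambda>h. k t * (\<Sum>j\<in>UNIV. partial j f (g x t) * (h + axis i (c t * h $ i)) $ j))) (at x)"
      using diff_chain_at[OF dg holo_on_has_derivative[OF f(1) gW]] that
      by (intro has_derivative_mult_right) (simp add: o_def)
    moreover have "k t * (\<Sum>j\<in>UNIV. partial j f (g x t) * (h + axis i (c t * h $ i)) $ j)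
        = (\<Sum>j\<in>UNIV. w j t * partial j f (g x t) * h $ j)" for h
    proof -
      have "(\<Sum>j\<in>UNIV. w j t * partial j f (g x t) * h $ j) =
         (\<Sum>j\<in>UNIV. k t * (partial j f (g x t) * h $ j) + (if j = i then k t * (partial i f (g x t) * (c t * h $ i)) else 0))"
        by (intro sum.cong) (auto simp: w_def algebra_simps)
      also have "\<dots> = k t * (\<Sum>j\<in>UNIV. partial j f (g x t) * h $ j) + k t * (partial i f (g x t) * (c t * h $ i))"
        by (simp add: sum.distrib sum_distrib_left)
      finally show ?thesis
        by (simp add: distrib_left sum.distrib sum_axis)
    qed
    ultimately show ?thesis
      by (simp add: A has_derivative_at_withinI)
  qed
  moreover have cg: "continuous_on (U \<times> {0..1}) (\<lambda>p. g (fst p) (snd p))"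
    unfolding g_def
    by (intro continuous_intros continuous_on_compose2[OF cont(1)] continuous_on_compose2[OF cont(2)])
       auto
  have cp: "continuous_on (U \<times> {0..1}) (\<lambda>p. partial j f (g (fst p) (snd p)))" for j
    by (rule continuous_on_compose2[OF f(2) cg]) (auto intro!: gW)
  have cf: "continuous_on (U \<times> {0..1}) (\<lambda>p. f (g (fst p) (snd p)))"
    by (rule continuous_on_compose2[OF holo_on_continuous_on[OF f(1)] cg]) (auto intro!: gW)
  have cw: "continuous_on {0..1} (w j)" for j
    unfolding w_def using cont by (cases "j = i") (auto intro!: continuous_intros)
  have slice: "continuous_on {0..1} (\<lambda>t. F (x, t))"
    if "continuous_on (U \<times> {0..1}) F" "x \<in> U" for F :: "(complex^'n) \<times> real \<Rightarrow> complex" and x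
    by (rule continuous_on_compose2[OF that(1)]) (use that in \<open>auto intro!: continuous_intros\<close>)
  have "(\<lambda>t. k t * f (g x t)) integrable_on cbox 0 1" if "x \<in> U" for x
    using slice[OF cf that] cont(3) by (auto intro!: integrable_continuous_real continuous_intros)
  moreover have cA: "continuous_on (U \<times> cbox 0 1) (\<lambda>(x, t). A x t)"
    unfolding split_beta
    by (rule continuous_on_blinfun_componentwise)
       (auto simp: A intro!: continuous_intros cp continuous_on_compose2[OF cw])
  ultimately have *: "((\<lambda>x. integral (cbox 0 1) (\<lambda>t. k t * f (g x t))) has_derivative
      integral (cbox 0 1) (A z)) (at z within U)"
    using U by (intro leibniz_rule)
  have "A z integrable_on cbox 0 1"
    by (rule integrable_continuous, rule continuous_on_compose2[OF cA, of _ "\<lambda>t. (z, t)", simplified])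
       (use U in \<open>auto intro!: continuous_intros\<close>)
  then have "blinfun_apply (integral (cbox 0 1) (A z)) h =
      (\<Sum>j\<in>UNIV. integral {0..1} (\<lambda>t. w j t * partial j f (g z t)) * h $ j)" for h
  proof -
    have "(\<lambda>t. w j t * partial j f (g z t)) integrable_on {0..1}" for j
      using slice[OF cp \<open>z \<in> U\<close>] cw by (auto intro!: integrable_continuous_real continuous_intros)
    then have "((\<lambda>t. \<Sum>j\<in>UNIV. w j t * partial j f (g z t) * h $ j) has_integral
        (\<Sum>j\<in>UNIV. integral {0..1} (\<lambda>t. w j t * partial j f (g z t)) * h $ j)) {0..1}"
      by (intro has_integral_sum has_integral_mult_left integrable_integral) auto
    then show ?thesis
      using \<open>A z integrable_on cbox 0 1\<close> by (simp add: blinfun_apply_integral A integral_unique)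
  qed
  then have "blinfun_apply (integral (cbox 0 1) (A z)) =
      (\<lambda>h. \<Sum>j\<in>UNIV. integral {0..1} (\<lambda>t. w j t * partial j f (g z t)) * h $ j)"
    by blast
  then show ?thesis
    using * at_within_open[OF \<open>z \<in> U\<close> \<open>open U\<close>] by (simp add: g_def w_def)
qed

text \<open>Half the radius of a ball inside \<open>W\<close> leaves room for a circle around every
  point of the smaller ball, so Cauchy's formula holds near \<open>z\<close> with one fixed
  radius.\<close>

lemma shift_neighbourhood:
  fixes z :: "complex^'n"
  assumes "open W" "z \<in> W"
  obtains \<rho> where "\<rho> > 0" "ball z \<rho> \<subseteq> W" "\<And>w u. w \<in> ball z \<rho> \<Longrightarrow> cmod u \<le> \<rho> \<Longrightarrow> w + axis i u \<in> W"
proof -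
  from assms obtain e where e: "e > 0" "ball z e \<subseteq> W"
    using open_contains_ball by blast
  show ?thesis
  proof (rule that[of "e / 2"])
    show "w + axis i u \<in> W" if "w \<in> ball z (e / 2)" "cmod u \<le> e / 2" for w u
    proof -
      have "norm (z - (w + axis i u)) \<le> norm (z - w) + norm (axis i u :: complex^'n)"
        by norm
      also have "\<dots> < e"
        using that by (simp add: norm_axis dist_norm)
      finally show ?thesis using e by (auto simp: dist_norm)
    qed
  qed (use e in auto)
qed

lemma continuous_on_circlepath [continuous_intros]:
  "continuous_on S g \<Longrightarrow> continuous_on S (\<lambda>x. circlepath z \<rho> (g x))"
  unfolding circlepath by (intro continuous_intros)

lemma norm_circlepath_0: "\<rho> > 0 \<Longrightarrow> cmod (circlepath 0 \<rho> t) = \<rho>"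
  by (simp add: circlepath norm_mult)

lemma continuous_on_circle_kernel:
  "\<rho> > 0 \<Longrightarrow> continuous_on S (\<lambda>t. inverse (circlepath 0 \<rho> t))"
  by (intro continuous_intros) (auto simp: circlepath)

text \<open>Near \<open>z\<close> the partial derivative is a Cauchy integral over circles of fixed
  radius, with integrand jointly continuous in the base point and the parameter. This supplies the
  continuity hypothesis of \<open>has_derivative_integral_shift\<close>.\<close>

lemma holo_on_continuous_partial:
  fixes W :: "(complex^'n) set"
  assumes "holo_on f W" "open W"
  shows "continuous_on W (partial i f)"
proof (rule continuous_at_imp_continuous_on, rule ballI)
  fix z assume "z \<in> W"
  from shift_neighbourhood[OF assms(2) this, of i] obtain \<rho>
    where \<rho>: "\<rho> > 0" "ball z \<rho> \<subseteq> W" "\<And>w u. w \<in> ball z \<rho> \<Longrightarrow> cmod u \<le> \<rho> \<Longrightarrow> w + axis i u \<in> W" by blast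
  have "continuous_on (ball z \<rho> \<times> {0..1})
      (\<lambda>p. f (fst p + axis i (circlepath 0 \<rho> (snd p))))"
    by (rule continuous_on_compose2[OF holo_on_continuous_on[OF assms(1)]])
       (use \<rho> in \<open>auto intro!: continuous_intros \<rho>(3) simp: norm_circlepath_0\<close>)
  then have "continuous_on (ball z \<rho> \<times> cbox 0 1) (\<lambda>(w, t). inverse (circlepath 0 \<rho> t)
      * f (w + axis i (circlepath 0 \<rho> t)))"
    unfolding split_beta using \<rho>(1)
    by (intro continuous_on_mult continuous_on_inverse) (auto intro!: continuous_intros simp: circlepath)
  from integral_continuous_on_param[OF this]
  have "continuous_on (ball z \<rho>) (\<lambda>w. integral {0..1} (\<lambda>t. inverse (circlepath 0 \<rho> t) * f (w + axis i (circlepath 0 \<rho> t))))"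
    by simp
  then have "continuous_on (ball z \<rho>) (partial i f)"
    by (rule continuous_on_eq) (use Cauchy_partial[OF assms(1) \<rho>(1) \<rho>(3)] in auto)
  then show "isCont (partial i f) z"
    using \<rho>(1) by (simp add: continuous_on_eq_continuous_at)
qed

text \<open>Cauchy's formula is differentiated under the integral. The coefficients stay visible as
  integrals, because each of them is again a Cauchy integral, now of \<open>partial j f\<close>;
  \<open>partial_commute\<close> relies on this.\<close>

lemma partial_has_derivative:
  fixes W :: "(complex^'n) set"
  assumes f: "holo_on f W" and W: "open W" and z: "z \<in> W"
  shows "\<exists>\<rho>>0. (\<forall>u. cmod u \<le> \<rho> \<longrightarrow> z + axis i u \<in> W) \<and>
    (partial i f has_derivative (\<lambda>h. \<Sum>j\<in>UNIV. integral {0..1} (\<lambda>t. inverse (circlepath 0 \<rho> t)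
        * partial j f (z + axis i (circlepath 0 \<rho> t))) * h $ j)) (at z)"
proof -
  from shift_neighbourhood[OF W z, of i] obtain \<rho>
    where \<rho>: "\<rho> > 0" "ball z \<rho> \<subseteq> W" "\<And>w u. w \<in> ball z \<rho> \<Longrightarrow> cmod u \<le> \<rho> \<Longrightarrow> w + axis i u \<in> W" by blast
  have "((\<lambda>z. integral {0..1} (\<lambda>t. inverse (circlepath 0 \<rho> t) *
        f (z + axis i (0 * z $ i + circlepath 0 \<rho> t)))) has_derivative
     (\<lambda>h. \<Sum>j\<in>UNIV. integral {0..1} (\<lambda>t. (if j = i then 1 + 0 else 1) * inverse (circlepath 0 \<rho> t)
        * partial j f (z + axis i (0 * z $ i + circlepath 0 \<rho> t))) * h $ j)) (at z)"
    by (rule has_derivative_integral_shift[OF f holo_on_continuous_partial[OF f W],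
          where U = "ball z \<rho>" and c = "\<lambda>_. 0" and d = "circlepath 0 \<rho>" and k = "\<lambda>t. inverse (circlepath 0 \<rho> t)"])
       (use \<rho>(1) in \<open>simp_all add: \<rho>(3) norm_circlepath_0 continuous_on_circle_kernel continuous_on_circlepath\<close>)
  then have *: "((\<lambda>z. integral {0..1} (\<lambda>t. inverse (circlepath 0 \<rho> t) *
        f (z + axis i (circlepath 0 \<rho> t)))) has_derivative
     (\<lambda>h. \<Sum>j\<in>UNIV. integral {0..1} (\<lambda>t. inverse (circlepath 0 \<rho> t)
        * partial j f (z + axis i (circlepath 0 \<rho> t))) * h $ j)) (at z)"
    by (simp cong: if_cong)
  have "(partial i f has_derivative (\<lambda>h. \<Sum>j\<in>UNIV. integral {0..1} (\<lambda>t. inverse (circlepath 0 \<rho> t)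
        * partial j f (z + axis i (circlepath 0 \<rho> t))) * h $ j)) (at z)"
    by (rule has_derivative_transform_within_open[OF *, of "ball z \<rho>"])
       (use \<rho> Cauchy_partial[OF f \<rho>(1) \<rho>(3)] in auto)
  then show ?thesis using \<rho> by (intro exI[of _ \<rho>]) auto
qed

lemma holo_on_partial:
  assumes "holo_on f W" "open W"
  shows "holo_on (partial i f) W"
proof -
  have "\<exists>a. (partial i f has_derivative (\<lambda>h. \<Sum>j\<in>UNIV. a j * h $ j)) (at z)" if "z \<in> W" for z
  proof -
    from partial_has_derivative[OF assms that, of i] obtain \<rho> where
      "(partial i f has_derivative (\<lambda>h. \<Sum>j\<in>UNIV. integral {0..1} (\<lambda>t. inverse (circlepath 0 \<rho> t)
        * partial j f (z + axis i (circlepath 0 \<rho> t))) * h $ j)) (at z)" by blast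
    then show ?thesis
      by (rule exI[of _ "\<lambda>j. integral {0..1} (\<lambda>t. inverse (circlepath 0 \<rho> t)
        * partial j f (z + axis i (circlepath 0 \<rho> t)))"])
  qed
  then obtain a where "\<And>z. z \<in> W \<Longrightarrow> (partial i f has_derivative (\<lambda>h. \<Sum>j\<in>UNIV. a z j * h $ j)) (at z)"
    by metis
  then show ?thesis by (rule holo_onI)
qed

text \<open>The \<open>j\<close>-th coefficient of the derivative of \<open>partial i f\<close> is
  the Cauchy integral in direction \<open>i\<close> of \<open>partial j f\<close>, which Cauchy's
  formula evaluates to \<open>partial i (partial j f)\<close>.\<close>

lemma partial_commute:
  assumes "holo_on f W" "open W" "z \<in> W"
  shows "partial j (partial i f) z = partial i (partial j f) z"
proof -
  from partial_has_derivative[OF assms, of i] obtain \<rho> where \<rho>: "\<rho> > 0" "\<And>u. cmod u \<le> \<rho> \<Longrightarrow> z + axis i u \<in> W"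
    and d: "(partial i f has_derivative (\<lambda>h. \<Sum>j\<in>UNIV. integral {0..1} (\<lambda>t. inverse (circlepath 0 \<rho> t)
        * partial j f (z + axis i (circlepath 0 \<rho> t))) * h $ j)) (at z)" by blast
  show ?thesis
    using has_derivative_partial_unique(2)[OF d] Cauchy_partial[OF holo_on_partial[OF assms(1,2)] \<rho>]
    by simp
qed

section \<open>Primitives in a coordinate direction on a ball\<close>

text \<open>Moving \<open>z $ i\<close> straight towards \<open>c $ i\<close> increases no component
  of \<open>z - c\<close> in modulus. Hence the ball contains the segments over which primitives are
  formed.\<close>

lemma ball_shrink_coordinate:
  fixes c :: "complex^'n"
  assumes "z \<in> ball c r" "t \<in> {0..1}"
  shows "z + axis i (complex_of_real (t - 1) * (z $ i - c $ i)) \<in> ball c r"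
proof -
  have "norm (z + axis i (complex_of_real (t - 1) * (z $ i - c $ i)) - c) \<le> norm (z - c)"
  proof (rule norm_le_componentwise_cart)
    fix j
    have "(z + axis i (complex_of_real (t - 1) * (z $ i - c $ i)) - c) $ j
        = (if j = i then complex_of_real t else 1) * (z - c) $ j"
      by (simp add: axis_def algebra_simps)
    then show "norm ((z + axis i (complex_of_real (t - 1) * (z $ i - c $ i)) - c) $ j) \<le> norm ((z - c) $ j)"
      using assms(2) by (auto simp: norm_mult intro!: mult_left_le_one_le)
  qed
  then show ?thesis using assms(1) by (simp add: dist_norm norm_minus_commute)
qed

text \<open>The integral of \<open>f\<close> along the segment in direction \<open>i\<close> that
  ends at \<open>z\<close> (\<open>t = 1\<close>) and starts where the \<open>i\<close>-th
  coordinate is \<open>c $ i\<close> (\<open>t = 0\<close>). Scaling to the fixed interval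
  \<open>{0..1}\<close> moves the dependence on \<open>z\<close> into the integrand.\<close>

definition axis_primitive :: "complex^'n \<Rightarrow> 'n::finite \<Rightarrow> (complex^'n \<Rightarrow> complex) \<Rightarrow> complex^'n \<Rightarrow> complex" where
  "axis_primitive c i f z =
     (z $ i - c $ i) * integral {0..1} (\<lambda>t. f (z + axis i (complex_of_real (t - 1) * (z $ i - c $ i))))"

lemma axis_primitive_cong:
  assumes "z \<in> ball c r" "\<And>w. w \<in> ball c r \<Longrightarrow> f w = g w"
  shows "axis_primitive c i f z = axis_primitive c i g z"
  unfolding axis_primitive_def
  by (intro arg_cong2[of _ _ _ _ "(*)"] refl integral_cong assms ball_shrink_coordinate)

text \<open>In a direction other than \<open>i\<close> the factor \<open>z $ i - c $ i\<close> is
  constant and the derivative passes under the integral. In direction \<open>i\<close> the product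
  rule gives \<open>I + (z $ i - c $ i) * P i\<close>, which the fundamental theorem of calculus
  identifies with \<open>f z\<close>.\<close>

lemma axis_primitive_has_derivative:
  fixes c :: "complex^'n"
  assumes f: "holo_on f (ball c r)" and z: "z \<in> ball c r"
  shows "(axis_primitive c i f has_derivative
     (\<lambda>h. \<Sum>j\<in>UNIV. (if j = i then f z else axis_primitive c i (partial j f) z) * h $ j)) (at z)"
proof -
  define \<gamma> where "\<gamma> t = z + axis i (complex_of_real (t - 1) * (z $ i - c $ i))" for t
  define I where "I = integral {0..1} (\<lambda>t. f (\<gamma> t))"
  \<comment> \<open>The weight in direction \<open>i\<close> is \<open>1 + (t - 1) = t\<close>,
    since the moving point contains \<open>z $ i\<close> only with the factor
    \<open>t\<close>.\<close>
  define P where "P j = integral {0..1} (\<lambda>t. (if j = i then complex_of_real t else 1) * partial j f (\<gamma> t))" for j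
  have \<gamma>: "\<gamma> t \<in> ball c r" if "t \<in> {0..1}" for t
    unfolding \<gamma>_def by (rule ball_shrink_coordinate[OF z that])
  have eq: "complex_of_real (t - 1) * w $ i + - complex_of_real (t - 1) * c $ i = complex_of_real (t - 1) * (w $ i - c $ i)" for t w
    by (simp add: algebra_simps)
  have "((\<lambda>z. integral {0..1} (\<lambda>t. 1 * f (z + axis i (complex_of_real (t - 1) * z $ i + - complex_of_real (t - 1) * c $ i)))) has_derivative
    (\<lambda>h. \<Sum>j\<in>UNIV. integral {0..1} (\<lambda>t. (if j = i then 1 + complex_of_real (t - 1) else 1) * 1
        * partial j f (z + axis i (complex_of_real (t - 1) * z $ i + - complex_of_real (t - 1) * c $ i))) * h $ j)) (at z)"
    by (rule has_derivative_integral_shift[OF f holo_on_continuous_partial[OF f open_ball] open_ball convex_ball z,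
          where k = "\<lambda>_. 1" and c = "\<lambda>t. complex_of_real (t - 1)" and d = "\<lambda>t. - complex_of_real (t - 1) * c $ i"])
       (unfold eq, auto intro!: continuous_intros ball_shrink_coordinate simp del: mem_ball of_real_diff)
  then have 1: "((\<lambda>z. integral {0..1} (\<lambda>t. f (z + axis i (complex_of_real (t - 1) * (z $ i - c $ i))))) has_derivative
    (\<lambda>h. \<Sum>j\<in>UNIV. P j * h $ j)) (at z)"
    unfolding eq P_def \<gamma>_def by (simp cong: if_cong)
  have 2: "((\<lambda>z. z $ i - c $ i) has_derivative (\<lambda>h. h $ i)) (at z)"
    by (auto intro!: derivative_eq_intros bounded_linear.has_derivative[OF bounded_linear_vec_nth])
  have FTC: "I + (z $ i - c $ i) * P i = f z"
  proof -
    define u where "u = z $ i - c $ i"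
    \<comment> \<open>\<open>t * f (\<gamma> t)\<close> is an antiderivative of the combined
      integrand; it runs from 0 at \<open>t = 0\<close> to \<open>f z\<close> at
      \<open>t = 1\<close>.\<close>
    have "((\<lambda>t. complex_of_real t * f (\<gamma> t)) has_vector_derivative
        f (\<gamma> t) + u * (complex_of_real t * partial i f (\<gamma> t))) (at t within {0..1})" if "t \<in> {0..1}" for t
    proof -
      have "((\<lambda>s. complex_of_real (s - 1) * u) has_vector_derivative u) (at t)"
        by (auto intro!: derivative_eq_intros simp: has_vector_derivative_def scaleR_conv_of_real algebra_simps)
      from field_vector_diff_chain_at[OF this has_field_derivative_along_axis[OF f \<gamma>[OF that, unfolded \<gamma>_def, folded u_def]]]
      have f\<gamma>: "((\<lambda>s. f (\<gamma> s)) has_vector_derivative u * partial i f (\<gamma> t)) (at t)"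
        by (simp add: o_def \<gamma>_def u_def)
      have "(complex_of_real has_vector_derivative of_real 1) (at t)"
        by (rule has_vector_derivative_of_real[OF DERIV_ident])
      from has_vector_derivative_mult[OF this f\<gamma>]
      have "((\<lambda>t. complex_of_real t * f (\<gamma> t)) has_vector_derivative
          complex_of_real t * (u * partial i f (\<gamma> t)) + of_real 1 * f (\<gamma> t)) (at t)" .
      from has_vector_derivative_at_within[OF this] show ?thesis
        by (simp add: algebra_simps)
    qed
    then have "((\<lambda>t. f (\<gamma> t) + u * (complex_of_real t * partial i f (\<gamma> t))) has_integral
        complex_of_real 1 * f (\<gamma> 1) - complex_of_real 0 * f (\<gamma> 0)) {0..1}"
      by (intro fundamental_theorem_of_calculus) auto
    then have a: "((\<lambda>t. f (\<gamma> t) + u * (complex_of_real t * partial i f (\<gamma> t))) has_integral f z) {0..1}"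
      by (simp add: \<gamma>_def)
    have c\<gamma>: "continuous_on {0..1} \<gamma>"
      unfolding \<gamma>_def by (intro continuous_intros)
    have "continuous_on {0..1} (\<lambda>t. f (\<gamma> t))"
      by (rule continuous_on_compose2[OF holo_on_continuous_on[OF f] c\<gamma>]) (use \<gamma> in auto)
    then have b: "((\<lambda>t. f (\<gamma> t)) has_integral I) {0..1}"
      unfolding I_def by (intro integrable_integral integrable_continuous_real)
    have "continuous_on {0..1} (\<lambda>t. partial i f (\<gamma> t))"
      by (rule continuous_on_compose2[OF holo_on_continuous_partial[OF f open_ball] c\<gamma>]) (use \<gamma> in auto)
    then have "((\<lambda>t. complex_of_real t * partial i f (\<gamma> t)) has_integral P i) {0..1}"
      unfolding P_def by (simp, intro integrable_integral integrable_continuous_real continuous_intros)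
    from has_integral_add[OF b has_integral_mult_right[OF this, of u]]
    have "((\<lambda>t. f (\<gamma> t) + u * (complex_of_real t * partial i f (\<gamma> t))) has_integral I + u * P i) {0..1}" .
    from has_integral_unique[OF this a] show ?thesis by (simp add: u_def)
  qed
  have "(axis_primitive c i f has_derivative
     (\<lambda>h. (z $ i - c $ i) * (\<Sum>j\<in>UNIV. P j * h $ j) + h $ i * I)) (at z)"
    unfolding axis_primitive_def[abs_def] I_def \<gamma>_def by (rule has_derivative_mult[OF 2 1])
  moreover have "(z $ i - c $ i) * (\<Sum>j\<in>UNIV. P j * h $ j) + h $ i * I
      = (\<Sum>j\<in>UNIV. (if j = i then f z else axis_primitive c i (partial j f) z) * h $ j)" for h
  proof -
    have "f z * h $ i = (z $ i - c $ i) * (P i * h $ i) + I * h $ i"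
      by (simp add: FTC[symmetric] algebra_simps)
    moreover have "axis_primitive c i (partial j f) z = (z $ i - c $ i) * P j" if "j \<noteq> i" for j
      using that by (simp add: P_def axis_primitive_def \<gamma>_def)
    ultimately have "(\<Sum>j\<in>UNIV. (if j = i then f z else axis_primitive c i (partial j f) z) * h $ j)
        = (\<Sum>j\<in>UNIV. (z $ i - c $ i) * (P j * h $ j) + (if j = i then I * h $ i else 0))"
      by (intro sum.cong) auto
    then show ?thesis by (simp add: sum.distrib sum_distrib_left mult.commute)
  qed
  ultimately show ?thesis by simp
qed

lemma
  fixes c :: "complex^'n"
  assumes "holo_on f (ball c r)"
  shows holo_on_axis_primitive: "holo_on (axis_primitive c i f) (ball c r)"
    and partial_axis_primitive: "z \<in> ball c r \<Longrightarrow>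
      partial j (axis_primitive c i f) z = (if j = i then f z else axis_primitive c i (partial j f) z)"
proof -
  show "holo_on (axis_primitive c i f) (ball c r)"
    by (rule holo_onI[OF axis_primitive_has_derivative[OF assms]])
  show "partial j (axis_primitive c i f) z = (if j = i then f z else axis_primitive c i (partial j f) z)"
    if "z \<in> ball c r"
    by (rule has_derivative_partial_unique(2)[OF axis_primitive_has_derivative[OF assms that]])
qed

lemma holo_on_combination:
  assumes "holo_on f W" "holo_on g W"
  shows "holo_on (\<lambda>z. a * f z + b * g z) W"
    and "z \<in> W \<Longrightarrow> partial i (\<lambda>z. a * f z + b * g z) z = a * partial i f z + b * partial i g z"
proof -
  have *: "((\<lambda>z. a * f z + b * g z) has_derivative
    (\<lambda>h. \<Sum>j\<in>UNIV. (a * partial j f z + b * partial j g z) * h $ j)) (at z)" if "z \<in> W" for z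
    using has_derivative_add[OF has_derivative_mult_right[OF holo_on_has_derivative[OF assms(1) that], of a]
        has_derivative_mult_right[OF holo_on_has_derivative[OF assms(2) that], of b]]
    by (simp add: sum_distrib_left sum.distrib distrib_right mult.assoc)
  show "holo_on (\<lambda>z. a * f z + b * g z) W"
    by (rule holo_onI[OF *])
  show "partial i (\<lambda>z. a * f z + b * g z) z = a * partial i f z + b * partial i g z" if "z \<in> W"
    by (rule has_derivative_partial_unique(2)[OF *[OF that]])
qed

section \<open>Monomial systems for commuting operators with primitives\<close>

text \<open>The algebra behind partial derivatives \<open>D i\<close> and axis primitives
  \<open>J i\<close> on a ball: \<open>J i\<close> is a right inverse of \<open>D i\<close> and
  commutes with the derivatives in the other directions. Solving monomial systems becomes a
  calculation with words.\<close>

locale commuting_primitives =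
  fixes H :: "'a::ab_group_add set" and D J :: "'n \<Rightarrow> 'a \<Rightarrow> 'a"
  assumes zero_in: "0 \<in> H"
    and add_in: "f \<in> H \<Longrightarrow> g \<in> H \<Longrightarrow> f + g \<in> H"
    and diff_in: "f \<in> H \<Longrightarrow> g \<in> H \<Longrightarrow> f - g \<in> H"
    and D_in: "f \<in> H \<Longrightarrow> D i f \<in> H"
    and J_in: "f \<in> H \<Longrightarrow> J i f \<in> H"
    and D_add: "f \<in> H \<Longrightarrow> g \<in> H \<Longrightarrow> D i (f + g) = D i f + D i g"
    and J_zero: "J i 0 = 0"
    and D_commute: "f \<in> H \<Longrightarrow> D i (D j f) = D j (D i f)"
    and D_J: "f \<in> H \<Longrightarrow> D i (J j f) = (if i = j then f else J j (D i f))"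
begin

lemma D_zero: "D i 0 = 0"
  using D_add[OF zero_in zero_in, of i] by simp

lemma D_diff: "f \<in> H \<Longrightarrow> g \<in> H \<Longrightarrow> D i (f - g) = D i f - D i g"
  using D_add[OF diff_in, of f g g i] by (simp add: eq_diff_eq)

abbreviation Ds :: "'n list \<Rightarrow> 'a \<Rightarrow> 'a" where "Ds \<equiv> foldr D"
abbreviation Js :: "'n list \<Rightarrow> 'a \<Rightarrow> 'a" where "Js \<equiv> foldr J"

lemma Ds_in: "f \<in> H \<Longrightarrow> Ds xs f \<in> H"
  by (induction xs) (auto intro: D_in)

lemma Js_in: "f \<in> H \<Longrightarrow> Js xs f \<in> H"
  by (induction xs) (auto intro: J_in)

lemma Ds_zero: "Ds xs 0 = 0"
  by (induction xs) (auto simp: D_zero)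

lemma Js_zero: "Js xs 0 = 0"
  by (induction xs) (auto simp: J_zero)

lemma Ds_add: "f \<in> H \<Longrightarrow> g \<in> H \<Longrightarrow> Ds xs (f + g) = Ds xs f + Ds xs g"
  by (induction xs) (auto simp: D_add Ds_in)

lemma Ds_diff: "f \<in> H \<Longrightarrow> g \<in> H \<Longrightarrow> Ds xs (f - g) = Ds xs f - Ds xs g"
  by (induction xs) (auto simp: D_diff Ds_in)

lemma D_Ds_commute: "f \<in> H \<Longrightarrow> D i (Ds xs f) = Ds xs (D i f)"
  by (induction xs) (auto simp: D_commute[of _ i] Ds_in)

lemma Ds_remove1: "f \<in> H \<Longrightarrow> x \<in> set xs \<Longrightarrow> Ds xs f = D x (Ds (remove1 x xs) f)"
  by (induction xs) (auto simp: D_commute[of _ x] Ds_in)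

lemma Ds_mset_cong: "f \<in> H \<Longrightarrow> mset xs = mset ys \<Longrightarrow> Ds xs f = Ds ys f"
proof (induction xs arbitrary: ys)
  case (Cons x xs)
  then have x: "x \<in> set ys" by (metis list.set_intros(1) set_mset_mset)
  from Cons.prems(2) have "mset xs = mset (remove1 x ys)"
    by (metis add_mset_remove_trivial mset.simps(2) mset_remove1)
  from Cons.IH[OF Cons.prems(1) this] have "Ds xs f = Ds (remove1 x ys) f" .
  with Ds_remove1[OF Cons.prems(1) x] show ?case by simp
qed simp

text \<open>The derivative passes the primitives in other directions and cancels against the first
  primitive in its own direction, so the order of the remaining primitives is kept.\<close>

lemma D_Js:
  "f \<in> H \<Longrightarrow> D y (Js xs f) = (if y \<in> set xs then Js (remove1 y xs) f else Js xs (D y f))"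
  by (induction xs) (auto simp: D_J Js_in)

lemma Ds_Js_same: "f \<in> H \<Longrightarrow> mset ys = mset xs \<Longrightarrow> Ds ys (Js xs f) = f"
proof (induction ys arbitrary: xs)
  case (Cons y ys)
  then have y: "y \<in> set xs" by (metis list.set_intros(1) set_mset_mset)
  from Cons.prems(2) have "mset ys = mset (remove1 y xs)"
    by (metis add_mset_remove_trivial mset.simps(2) mset_remove1)
  from Cons.IH[OF Cons.prems(1) this] show ?case
    using y D_Ds_commute[OF Js_in[OF Cons.prems(1)]] D_Js[OF Cons.prems(1)]
    by simp
qed simp

text \<open>Letters common to \<open>ys\<close> and \<open>xs\<close> cancel. The surplus letters of
  \<open>ys\<close> pass through the primitives that remain, reach \<open>f\<close> and kill it, and
  primitives of zero are zero.\<close>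

lemma Ds_Js_eq_zero:
  assumes "f \<in> H" "mset zs = mset ys - mset xs" "Ds zs f = 0"
  shows "Ds ys (Js xs f) = 0"
  using assms
proof (induction ys arbitrary: xs zs f)
  case Nil
  then show ?case by (simp add: Js_zero)
next
  case (Cons y ys)
  have *: "Ds (y # ys) (Js xs f) = Ds ys (D y (Js xs f))"
    using D_Ds_commute[OF Js_in[OF Cons.prems(1)]] by simp
  show ?case
  proof (cases "y \<in> set xs")
    case True
    then have "mset zs = mset ys - mset (remove1 y xs)"
      using Cons.prems(2) by (simp add: multiset_eq_iff)
    from Cons.IH[OF Cons.prems(1) this Cons.prems(3)] show ?thesis
      using True * D_Js[OF Cons.prems(1)] by simp
  next
    case False
    then have c: "mset zs = add_mset y (mset ys - mset xs)"
      using Cons.prems(2) by (simp add: add_mset_diff_bothsides minus_add_mset_if_not_in_lhs count_eq_zero_iff multiset_eq_iff)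
    \<comment> \<open>The surplus letter \<open>y\<close> meets no primitive of its own direction.
      It moves from \<open>zs\<close> onto \<open>f\<close>, and \<open>zs'\<close> is left for the
      induction hypothesis.\<close>
    obtain zs' where zs': "mset zs' = mset ys - mset xs" by (metis ex_mset)
    have "Ds zs' (D y f) = Ds zs f"
      using Ds_mset_cong[OF Cons.prems(1), of zs "y # zs'"] c zs' D_Ds_commute[OF Cons.prems(1)] by simp
    with Cons.IH[OF D_in[OF Cons.prems(1)] zs'] Cons.prems(3) False * D_Js[OF Cons.prems(1)]
    show ?thesis by simp
  qed
qed

theorem compatible_system_solvable:
  assumes "finite \<U>"
    and "\<And>U. U \<in> \<U> \<Longrightarrow> f U \<in> H"
    and "\<And>U U' xs ys. U \<in> \<U> \<Longrightarrow> U' \<in> \<U> \<Longrightarrow> mset xs = U' - U \<Longrightarrow> mset ys = U - U' \<Longrightarrow>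
          Ds xs (f U) = Ds ys (f U')"
  shows "\<exists>L\<in>H. \<forall>xs. mset xs \<in> \<U> \<longrightarrow> Ds xs L = f (mset xs)"
  using assms
proof (induction \<U>)
  case empty
  show ?case using zero_in by auto
next
  case (insert U \<U>)
  then obtain L where L: "L \<in> H" "\<And>xs. mset xs \<in> \<U> \<Longrightarrow> Ds xs L = f (mset xs)"
    by (metis insertI2)
  obtain us where us: "mset us = U" by (metis ex_mset)
  \<comment> \<open>The defect of \<open>L\<close> in the new equation; \<open>Js us h\<close> is a
    correction whose derivative along \<open>U\<close> is exactly \<open>h\<close>.\<close>
  define h where "h = f U - Ds us L"
  have fU: "f U \<in> H" using insert.prems(1) by simp
  have h: "h \<in> H" unfolding h_def by (intro diff_in fU Ds_in L(1))
  have "Ds xs (L + Js us h) = f (mset xs)" if xs: "mset xs \<in> insert U \<U>" for xs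
  proof (cases "mset xs = U")
    case True
    have "Ds xs (L + Js us h) = Ds us L + h"
      using Ds_add[OF L(1) Js_in[OF h]] Ds_Js_same[OF h, of xs us] Ds_mset_cong[OF L(1), of xs us] True us by simp
    then show ?thesis by (simp add: h_def True)
  next
    case False
    with xs have U': "mset xs \<in> \<U>" by simp
    obtain zs where zs: "mset zs = mset xs - U" by (metis ex_mset)
    obtain zs' where zs': "mset zs' = U - mset xs" by (metis ex_mset)
    \<comment> \<open>Both sides differentiate \<open>L\<close> along the union of the multisets
      \<open>U\<close> and \<open>mset xs\<close>, completed from either one.\<close>
    have "Ds zs (Ds us L) = Ds zs' (Ds xs L)"
    proof -
      have "count (mset (zs @ us)) a = count (mset (zs' @ xs)) a" for a
        using zs zs' us by simp
      then have "mset (zs @ us) = mset (zs' @ xs)" by (rule multiset_eqI)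
      from Ds_mset_cong[OF L(1) this] show ?thesis by simp
    qed
    also have "\<dots> = Ds zs (f U)"
      using insert.prems(2)[OF _ _ zs zs'] U' L(2) by simp
    \<comment> \<open>The letters of \<open>xs\<close> left after cancelling \<open>U\<close> kill
      the defect, so the correction does not disturb the equation for
      \<open>mset xs\<close>.\<close>
    finally have "Ds zs h = 0"
      unfolding h_def using Ds_diff[OF fU Ds_in[OF L(1)]] by simp
    then have "Ds xs (Js us h) = 0"
      using Ds_Js_eq_zero[OF h, of zs xs us] zs us by simp
    then show ?thesis
      using Ds_add[OF L(1) Js_in[OF h]] L(2)[OF U'] by simp
  qed
  moreover have "L + Js us h \<in> H" by (intro add_in L(1) Js_in h)
  ultimately show ?case by blast
qed

end

section \<open>Compatibility of closed data through basis exchange\<close>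

text \<open>The concatenations have equal size, so if they differ as multisets, some
  \<open>a\<close> is more frequent in the second. Comparing its multiplicities slot by slot yields
  \<open>j\<close>; as the lists are distinct, a larger multiplicity means present against
  absent.\<close>

lemma exists_surplus_index:
  assumes "length Is = length Is'" "mset (concat Is) \<noteq> mset (concat Is')"
    and k: "\<And>I. I \<in> set Is \<union> set Is' \<Longrightarrow> length I = k \<and> distinct I"
  obtains a j where "j < length Is" "a \<in> set (Is' ! j) - set (Is ! j)"
    "count (mset (concat Is)) a < count (mset (concat Is')) a"
proof -
  have "size (mset (concat Is)) = size (mset (concat Is'))"
  proof -
    have "length (concat Xs) = k * length Xs" if "\<And>I. I \<in> set Xs \<Longrightarrow> length I = k" for Xs :: "'a list list"
      using that by (induction Xs) auto
    with assms show ?thesis by (metis UnI1 UnI2 size_mset)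
  qed
  with assms(2) have "\<not> mset (concat Is') \<subseteq># mset (concat Is)"
    by (metis mset_subset_size nless_le subset_mset.less_le order_less_irrefl)
  then obtain a where a: "count (mset (concat Is)) a < count (mset (concat Is')) a"
    by (meson not_le subseteq_mset_def)
  have c: "count (mset (concat Xs)) a = (\<Sum>j<length Xs. count (mset (Xs ! j)) a)" for Xs :: "'a list list"
  proof -
    have "count (mset (concat Xs)) a = sum_list (map (\<lambda>I. count (mset I) a) Xs)"
      by (induction Xs) auto
    then show ?thesis by (simp add: sum_list_sum_nth atLeast0LessThan)
  qed
  have "\<exists>j<length Is. count (mset (Is ! j)) a < count (mset (Is' ! j)) a"
  proof (rule ccontr)
    assume N: "\<not> ?thesis"
    have "(\<Sum>j<length Is'. count (mset (Is' ! j)) a) \<le> (\<Sum>j<length Is. count (mset (Is ! j)) a)"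
      unfolding assms(1) by (intro sum_mono) (use N assms(1) in \<open>metis lessThan_iff not_less\<close>)
    with a c show False by simp
  qed
  then obtain j where j: "j < length Is" "count (mset (Is ! j)) a < count (mset (Is' ! j)) a" by blast
  have "a \<in> set (Is' ! j)" using j(2) by (metis count_mset_0_iff less_nat_zero_code)
  moreover have "a \<notin> set (Is ! j)"
  proof
    assume "a \<in> set (Is ! j)"
    then have "count (mset (Is ! j)) a \<ge> 1" by (simp add: Suc_le_eq)
    moreover have "count (mset (Is' ! j)) a \<le> 1"
      using k[of "Is' ! j"] j(1) assms(1) by (simp add: distinct_count_atmost_1)
    ultimately show False using j(2) by linarith
  qed
  ultimately show ?thesis using that j(1) a by blast
qed

context commuting_primitives
begin

text \<open>The functions \<open>f (add_mset i T)\<close> are like the components of a closed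
  1-form. Either the two pairs agree, or \<open>i'\<close> occurs in \<open>xs\<close> and
  \<open>i\<close> in \<open>xs'\<close>, and one use of closedness interchanges these two
  indices.\<close>

lemma path_compatible_same:
  assumes closed: "\<And>i j. D j (f (add_mset i T)) = D i (f (add_mset j T))"
    and f_in: "\<And>i. f (add_mset i T) \<in> H"
    and eq: "add_mset i (mset xs) = add_mset i' (mset xs')"
  shows "Ds xs (f (add_mset i T)) = Ds xs' (f (add_mset i' T))"
  using eq unfolding add_eq_conv_ex
proof (elim disjE exE conjE)
  fix K assume K: "mset xs = add_mset i' K" "mset xs' = add_mset i K"
  obtain ys where ys: "mset ys = K" by (metis ex_mset)
  have "Ds xs (f (add_mset i T)) = Ds ys (D i' (f (add_mset i T)))"
    using Ds_mset_cong[OF f_in, of xs "i' # ys" i] K ys D_Ds_commute[OF f_in] by simp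
  also have "\<dots> = Ds ys (D i (f (add_mset i' T)))"
    by (simp add: closed)
  also have "\<dots> = Ds xs' (f (add_mset i' T))"
    using Ds_mset_cong[OF f_in, of xs' "i # ys" i'] K ys D_Ds_commute[OF f_in] by simp
  finally show ?thesis .
next
  assume "mset xs = mset xs'" "i = i'"
  with Ds_mset_cong[OF f_in this(1)] show ?thesis by simp
qed

text \<open>
  One exchange step changes the multiset \<open>T\<close> of all indices into \<open>T - b + a\<close>, and
  \<open>(T - b + a) + b = T + a\<close>: both ends of the step share a member of the family \<open>f\<close>.
  As \<open>a\<close> is taken from the target, all multisets on the way stay below the fixed total.
\<close>
lemma path_compatible:
  fixes B :: "'n list set"
  assumes B: "\<And>I. I \<in> B \<Longrightarrow> length I = k \<and> distinct I"
    and exchange: "\<And>I I' a. I \<in> B \<Longrightarrow> I' \<in> B \<Longrightarrow> a \<in> set I' - set I \<Longrightarrow>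
          \<exists>b\<in>set I - set I'. a # remove1 b I \<in> B"
    and f_in: "\<And>Is i. set Is \<subseteq> B \<Longrightarrow> length Is = m \<Longrightarrow> f (mset (i # concat Is)) \<in> H"
    and closed: "\<And>Is i j. set Is \<subseteq> B \<Longrightarrow> length Is = m \<Longrightarrow>
          D j (f (mset (i # concat Is))) = D i (f (mset (j # concat Is)))"
    and Is': "set Is' \<subseteq> B" "length Is' = m"
    and Is: "set Is \<subseteq> B" "length Is = m"
    and eq: "mset xs + mset (i # concat Is) = mset xs' + mset (i' # concat Is')"
  shows "Ds xs (f (mset (i # concat Is))) = Ds xs' (f (mset (i' # concat Is')))"
  using Is eq
\<comment> \<open>The measure counts, slot by slot, the entries of \<open>Is\<close> that the target
  \<open>Is'\<close> lacks; each exchange lowers it.\<close>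
proof (induction "\<Sum>j<m. card (set (Is ! j) - set (Is' ! j))" arbitrary: Is i xs rule: less_induct)
  case less
  note same = path_compatible_same[of f "mset (concat Is)", OF closed[OF less.prems(1,2), simplified] f_in[OF less.prems(1,2), simplified]]
  show ?case
  proof (cases "mset (concat Is) = mset (concat Is')")
    case True
    with less.prems(3) same[of i xs i' xs'] show ?thesis by simp
  next
    case False
    obtain a j where j: "j < m" and aj: "a \<in> set (Is' ! j) - set (Is ! j)"
      and a: "count (mset (concat Is)) a < count (mset (concat Is')) a"
      using exists_surplus_index[of Is Is' k] False less.prems(1,2) Is' B by (metis UnE subsetD)
    have IB: "Is ! j \<in> B" "Is' ! j \<in> B"
      using less.prems(1,2) Is' j by (auto simp: subset_iff)
    from exchange[OF IB aj] obtain b where b: "b \<in> set (Is ! j) - set (Is' ! j)" "a # remove1 b (Is ! j) \<in> B"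
      by blast
    define Js where "Js = Is[j := a # remove1 b (Is ! j)]"
    have Js: "set Js \<subseteq> B" "length Js = m"
      using less.prems(1,2) b(2) set_update_subset_insert[of Is j] by (auto simp: Js_def)
    have T: "add_mset b (mset (concat Js)) = add_mset a (mset (concat Is))"
    proof -
      have "Is = take j Is @ Is ! j # drop (Suc j) Is"
        using j less.prems(2) by (simp add: id_take_nth_drop)
      then have 1: "mset (concat Is) = mset (concat (take j Is)) + mset (Is ! j) + mset (concat (drop (Suc j) Is))"
        by (metis concat.simps(2) concat_append mset_append add.assoc)
      define R where "R = mset (remove1 b (Is ! j))"
      have 2: "mset (concat Js) = mset (concat (take j Is)) + add_mset a R + mset (concat (drop (Suc j) Is))"
        using j less.prems(2) by (simp add: Js_def R_def upd_conv_take_nth_drop)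
      have 3: "mset (Is ! j) = add_mset b R"
        using b(1) by (simp add: R_def)
      show ?thesis unfolding 1 2 3 by simp
    qed
    \<comment> \<open>The total contains \<open>mset (concat Is')\<close> and hence more copies of
      \<open>a\<close> than \<open>concat Is\<close>. So \<open>a\<close> is available as
      \<open>i\<close> or as a letter of \<open>xs\<close>.\<close>
    have "count (mset (concat Is')) a \<le> count (mset xs + mset (i # concat Is)) a"
      unfolding less.prems(3) by simp
    moreover have "count (mset xs + mset (i # concat Is)) a
        = count (add_mset i (mset xs)) a + count (mset (concat Is)) a" by simp
    ultimately have "0 < count (add_mset i (mset xs)) a" using a by linarith
    then have "a \<in># add_mset i (mset xs)" by (simp only: count_greater_zero_iff)
    then obtain ys where ys: "add_mset a (mset ys) = add_mset i (mset xs)"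
      by (metis ex_mset insert_DiffM)
    \<comment> \<open>First \<open>a\<close> becomes the index of the member over \<open>Is\<close>;
      by \<open>T\<close> this member is also the one with index \<open>b\<close> over
      \<open>Js\<close>.\<close>
    have "Ds xs (f (mset (i # concat Is))) = Ds ys (f (mset (b # concat Js)))"
      using same[OF ys[symmetric]] unfolding T[symmetric] by (simp only: mset.simps)
    also have "\<dots> = Ds xs' (f (mset (i' # concat Is')))"
    proof (rule less.hyps[OF _ Js])
      have "mset ys + mset (b # concat Js) = mset ys + add_mset a (mset (concat Is))"
        by (simp only: T mset.simps)
      also have "\<dots> = add_mset a (mset ys) + mset (concat Is)"
        by simp
      also have "\<dots> = mset xs + mset (i # concat Is)"
        unfolding ys by simp
      finally show "mset ys + mset (b # concat Js) = mset xs' + mset (i' # concat Is')"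
        unfolding less.prems(3) .
      have l: "card (set (Js ! j) - set (Is' ! j)) < card (set (Is ! j) - set (Is' ! j))"
      proof -
        \<comment> \<open>\<open>b\<close> leaves the difference, and \<open>a\<close> does not
          enter it because it belongs to \<open>Is' ! j\<close>.\<close>
        have "set (Js ! j) - set (Is' ! j) = set (Is ! j) - set (Is' ! j) - {b}"
          using aj j less.prems(2) B[OF IB(1)] by (auto simp: Js_def)
        moreover have "card (set (Is ! j) - set (Is' ! j) - {b}) < card (set (Is ! j) - set (Is' ! j))"
          by (rule card_Diff1_less) (use b(1) in auto)
        ultimately show ?thesis by (simp only:)
      qed
      show "(\<Sum>j<m. card (set (Js ! j) - set (Is' ! j))) < (\<Sum>j<m. card (set (Is ! j) - set (Is' ! j)))"
      proof (rule sum_strict_mono_ex1)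
        show "\<forall>l\<in>{..<m}. card (set (Js ! l) - set (Is' ! l)) \<le> card (set (Is ! l) - set (Is' ! l))"
        proof
          fix p show "card (set (Js ! p) - set (Is' ! p)) \<le> card (set (Is ! p) - set (Is' ! p))"
            using l by (cases "p = j") (auto simp: Js_def)
        qed
      qed (use l j in auto)
    qed
    finally show ?thesis .
  qed
qed

section \<open>Solvability for closed and for constant data\<close>

lemma closed_system_solvable:
  fixes B :: "'n list set"
  assumes fin: "finite (UNIV :: 'n set)"
    and B: "\<And>I. I \<in> B \<Longrightarrow> length I = k \<and> distinct I"
    and exchange: "\<And>I I' a. I \<in> B \<Longrightarrow> I' \<in> B \<Longrightarrow> a \<in> set I' - set I \<Longrightarrow>
          \<exists>b\<in>set I - set I'. a # remove1 b I \<in> B"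
    and f_in: "\<And>Is i. set Is \<subseteq> B \<Longrightarrow> length Is = m \<Longrightarrow> f (mset (i # concat Is)) \<in> H"
    and closed: "\<And>Is i j. set Is \<subseteq> B \<Longrightarrow> length Is = m \<Longrightarrow>
          D j (f (mset (i # concat Is))) = D i (f (mset (j # concat Is)))"
  obtains L where "L \<in> H"
    "\<And>Is i. set Is \<subseteq> B \<Longrightarrow> length Is = m \<Longrightarrow> Ds (i # concat Is) L = f (mset (i # concat Is))"
proof -
  define \<U> where "\<U> = (\<lambda>(i, Is). mset (i # concat Is)) ` (UNIV \<times> {Is. set Is \<subseteq> B \<and> length Is = m})"
  have "finite {I. set I \<subseteq> (UNIV :: 'n set) \<and> length I = k}"
    by (rule finite_lists_length_eq[OF fin])
  then have "finite B" by (rule finite_subset[rotated]) (use B in auto)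
  then have "finite \<U>"
    unfolding \<U>_def by (intro finite_imageI finite_cartesian_product fin finite_lists_length_eq)
  moreover have "f U \<in> H" if "U \<in> \<U>" for U
    using that f_in unfolding \<U>_def by auto
  moreover have "Ds xs (f U) = Ds ys (f U')"
    if UU: "U \<in> \<U>" "U' \<in> \<U>" "mset xs = U' - U" "mset ys = U - U'" for U U' xs ys
  proof -
    obtain i Is where U: "U = mset (i # concat Is)" and Is: "set Is \<subseteq> B" "length Is = m"
      using UU(1) unfolding \<U>_def by auto
    obtain i' Is' where U': "U' = mset (i' # concat Is')" and Is': "set Is' \<subseteq> B" "length Is' = m"
      using UU(2) unfolding \<U>_def by auto
    \<comment> \<open>Both sums are the union of \<open>U\<close> and \<open>U'\<close>, which
      serves as the common total in \<open>path_compatible\<close>.\<close>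
    have "mset xs + U = mset ys + U'"
      unfolding that(3,4) by (rule multiset_eqI) simp
    from path_compatible[of B k m f, OF B exchange f_in closed Is' Is this[unfolded U U']] show ?thesis
      unfolding U U' .
  qed
  ultimately obtain L where L: "L \<in> H" "\<forall>xs. mset xs \<in> \<U> \<longrightarrow> Ds xs L = f (mset xs)"
    using compatible_system_solvable[of \<U> f] by blast
  show ?thesis
  proof (rule that[OF L(1)])
    fix Is i assume "set Is \<subseteq> B" "length Is = m"
    then have "mset (i # concat Is) \<in> \<U>"
      unfolding \<U>_def by (intro image_eqI[of _ _ "(i, Is)"]) auto
    with L(2) show "Ds (i # concat Is) L = f (mset (i # concat Is))" by blast
  qed
qed

text \<open>All prescribed monomials have degree \<open>k * m\<close>, so neither of two different
  ones divides the other. Both sides of the compatibility condition are then derivatives of positive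
  order of constants, hence zero.\<close>

lemma constant_system_solvable:
  fixes B :: "'n list set"
  assumes fin: "finite (UNIV :: 'n set)"
    and B: "\<And>I. I \<in> B \<Longrightarrow> length I = k"
    and f_in: "\<And>Is. set Is \<subseteq> B \<Longrightarrow> length Is = m \<Longrightarrow> f (mset (concat Is)) \<in> H"
    and const: "\<And>Is j. set Is \<subseteq> B \<Longrightarrow> length Is = m \<Longrightarrow> D j (f (mset (concat Is))) = 0"
  obtains L where "L \<in> H"
    "\<And>Is. set Is \<subseteq> B \<Longrightarrow> length Is = m \<Longrightarrow> Ds (concat Is) L = f (mset (concat Is))"
proof -
  define \<U> where "\<U> = (\<lambda>Is. mset (concat Is)) ` {Is. set Is \<subseteq> B \<and> length Is = m}"
  have "finite {I. set I \<subseteq> (UNIV :: 'n set) \<and> length I = k}"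
    by (rule finite_lists_length_eq[OF fin])
  then have "finite B" by (rule finite_subset[rotated]) (use B in auto)
  then have "finite \<U>"
    unfolding \<U>_def by (intro finite_imageI finite_lists_length_eq)
  moreover have fH: "f U \<in> H" if "U \<in> \<U>" for U
    using that f_in unfolding \<U>_def by auto
  moreover have "Ds xs (f U) = Ds ys (f U')"
    if "U \<in> \<U>" "U' \<in> \<U>" "mset xs = U' - U" "mset ys = U - U'" for U U' xs ys
  proof -
    have size: "size U = k * m" if U: "U \<in> \<U>" for U
    proof -
      have "length (concat Is) = k * length Is" if "set Is \<subseteq> B" for Is
        using that B by (induction Is) auto
      with U show ?thesis unfolding \<U>_def by force
    qed
    have vanish: "Ds zs (f U) = 0" if "U \<in> \<U>" "zs \<noteq> []" for U zs
    proof -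
      from that(2) obtain z zs' where "zs = z # zs'" by (cases zs) auto
      moreover have "D z (f U) = 0" using that(1) const unfolding \<U>_def by auto
      ultimately show ?thesis
        using D_Ds_commute[OF fH[OF that(1)]] Ds_zero by simp
    qed
    show ?thesis
    proof (cases "U = U'")
      case False
      have "\<not> U \<subseteq># U'" "\<not> U' \<subseteq># U"
        using False size[OF that(1)] size[OF that(2)]
        by (metis mset_subset_size less_irrefl subset_mset.le_neq_trans)+
      with that(3,4) have "xs \<noteq> []" "ys \<noteq> []"
        by (auto simp: Diff_eq_empty_iff_mset)
      with vanish that show ?thesis by simp
    qed (use that in simp)
  qed
  ultimately obtain L where L: "L \<in> H" "\<forall>xs. mset xs \<in> \<U> \<longrightarrow> Ds xs L = f (mset xs)"
    using compatible_system_solvable[of \<U> f] by blast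
  show ?thesis
  proof (rule that[OF L(1)])
    fix Is assume "set Is \<subseteq> B" "length Is = m"
    then have "mset (concat Is) \<in> \<U>"
      unfolding \<U>_def by (intro image_eqI[of _ _ "Is"]) auto
    with L(2) show "Ds (concat Is) L = f (mset (concat Is))" by blast
  qed
qed

end

section \<open>Monomial systems of partial differential equations on a ball\<close>

definition holo_functions :: "(complex^'n::finite) set \<Rightarrow> (complex^'n \<Rightarrow> complex) set" where
  "holo_functions W = {f. holo_on f W \<and> (\<forall>z. z \<notin> W \<longrightarrow> f z = 0)}"

text \<open>
  The values of functions outside the domain are irrelevant; they are set to zero such that
  the identities between the operators become equations between functions.
\<close>
definition cutoff :: "'a set \<Rightarrow> ('a \<Rightarrow> complex) \<Rightarrow> 'a \<Rightarrow> complex" where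
  "cutoff W f = (\<lambda>z. if z \<in> W then f z else 0)"

lemma cutoff_apply: "z \<in> W \<Longrightarrow> cutoff W f z = f z"
  by (simp add: cutoff_def)

lemma cutoff_cong: "(\<And>z. z \<in> W \<Longrightarrow> f z = g z) \<Longrightarrow> cutoff W f = cutoff W g"
  by (auto simp: cutoff_def)

lemma cutoff_ident: "f \<in> holo_functions W \<Longrightarrow> cutoff W f = f"
  by (auto simp: cutoff_def holo_functions_def)

lemma cutoff_in: "open W \<Longrightarrow> holo_on f W \<Longrightarrow> cutoff W f \<in> holo_functions W"
  by (auto simp: holo_functions_def cutoff_def intro: holo_on_cong[of W f])

lemma partial_cutoff: "open W \<Longrightarrow> z \<in> W \<Longrightarrow> partial i (cutoff W f) z = partial i f z"
  by (rule partial_cong) (auto simp: cutoff_def)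

lemma holo_functionsD: "f \<in> holo_functions W \<Longrightarrow> holo_on f W"
  by (simp add: holo_functions_def)

lemma holo_on_const: "holo_on (\<lambda>z. a) W"
  by (rule holo_onI[where a = "\<lambda>_ _. 0"]) simp

text \<open>\<open>D_commute\<close> is the symmetry of second derivatives, and \<open>D_J\<close>
  is the derivative of an axis primitive, formed from the hyperplane through the centre
  \<open>c\<close>.\<close>

lemma commuting_primitives_ball:
  fixes c :: "complex^'n"
  shows "commuting_primitives (holo_functions (ball c r))
     (\<lambda>i f. cutoff (ball c r) (partial i f)) (\<lambda>i f. cutoff (ball c r) (axis_primitive c i f))"
proof
  let ?W = "ball c r"
  show "0 \<in> holo_functions ?W"
    by (simp add: holo_functions_def zero_fun_def holo_on_const)
  have lin: "(\<lambda>z. f z + b * g z) \<in> holo_functions ?W"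
    "z \<in> ?W \<Longrightarrow> partial i (\<lambda>z. f z + b * g z) z = partial i f z + b * partial i g z"
    if "f \<in> holo_functions ?W" "g \<in> holo_functions ?W" for f g :: "complex^'n \<Rightarrow> complex" and b i z
    using that holo_on_combination[where f = f and g = g and W = ?W and a = 1 and b = b] by (simp_all add: holo_functions_def)
  fix f g :: "complex^'n \<Rightarrow> complex" assume f: "f \<in> holo_functions ?W"
  note hf = holo_functionsD[OF f]
  show "cutoff ?W (partial i f) \<in> holo_functions ?W" for i
    by (intro cutoff_in holo_on_partial hf open_ball)
  show "cutoff ?W (axis_primitive c i f) \<in> holo_functions ?W" for i
    by (intro cutoff_in holo_on_axis_primitive hf open_ball)
  show "cutoff ?W (partial i (cutoff ?W (partial j f))) = cutoff ?W (partial j (cutoff ?W (partial i f)))" for i j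
    by (rule cutoff_cong) (simp add: partial_cutoff partial_commute[OF hf] del: mem_ball)
  show "cutoff ?W (partial i (cutoff ?W (axis_primitive c j f))) =
      (if i = j then f else cutoff ?W (axis_primitive c j (cutoff ?W (partial i f))))" for i j
  proof (cases "i = j")
    case True
    have "cutoff ?W (partial i (cutoff ?W (axis_primitive c j f))) = cutoff ?W f"
      by (rule cutoff_cong) (simp add: partial_cutoff partial_axis_primitive[OF hf] True del: mem_ball)
    with True show ?thesis by (simp add: cutoff_ident[OF f])
  next
    case False
    have "axis_primitive c j (partial i f) z = axis_primitive c j (cutoff ?W (partial i f)) z"
      if "z \<in> ?W" for z
      by (rule axis_primitive_cong[OF that]) (simp add: cutoff_apply del: mem_ball)
    then have "cutoff ?W (partial i (cutoff ?W (axis_primitive c j f))) = cutoff ?W (axis_primitive c j (cutoff ?W (partial i f)))"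
      using False by (intro cutoff_cong) (simp add: partial_cutoff partial_axis_primitive[OF hf] del: mem_ball)
    with False show ?thesis by simp
  qed
  assume g: "g \<in> holo_functions ?W"
  show "f + g \<in> holo_functions ?W"
    using lin(1)[OF f g, of 1] by (simp add: plus_fun_def)
  show "f - g \<in> holo_functions ?W"
    using lin(1)[OF f g, of "-1"] by (simp add: fun_diff_def)
  show "cutoff ?W (partial i (f + g)) = cutoff ?W (partial i f) + cutoff ?W (partial i g)" for i
    using lin(2)[OF f g, of _ i 1] by (simp add: fun_eq_iff cutoff_def plus_fun_def)
next
  show "cutoff (ball c r) (axis_primitive c i 0) = 0" for i
    by (simp add: cutoff_def axis_primitive_def fun_eq_iff)
qed

text \<open>\<open>partial\<close> sees only values near the point, so cutting off outside the open
  set \<open>W\<close> after each differentiation changes nothing inside.\<close>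

lemma partials_cutoff:
  assumes "open W" "z \<in> W"
  shows "foldr (\<lambda>i f. cutoff W (partial i f)) xs f z = partials xs f z"
  using assms(2)
proof (induction xs arbitrary: z)
  case (Cons x xs)
  have "partial x (foldr (\<lambda>i f. cutoff W (partial i f)) xs f) z = partial x (partials xs f) z"
    by (rule partial_cong[OF assms(1) Cons.prems Cons.IH])
  with Cons.prems show ?case by (simp add: cutoff_apply partials_def)
qed (simp add: partials_def)

lemma closed_partials_system_solvable:
  fixes c :: "complex^'n" and B :: "'n list set"
  assumes B: "\<And>I. I \<in> B \<Longrightarrow> length I = k \<and> distinct I"
    and exchange: "\<And>I I' a. I \<in> B \<Longrightarrow> I' \<in> B \<Longrightarrow> a \<in> set I' - set I \<Longrightarrow>
          \<exists>b\<in>set I - set I'. a # remove1 b I \<in> B"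
    and holo: "\<And>Is i. set Is \<subseteq> B \<Longrightarrow> length Is = m \<Longrightarrow> holo_on (f (mset (i # concat Is))) (ball c r)"
    and closed: "\<And>Is i j z. set Is \<subseteq> B \<Longrightarrow> length Is = m \<Longrightarrow> z \<in> ball c r \<Longrightarrow>
          partial j (f (mset (i # concat Is))) z = partial i (f (mset (j # concat Is))) z"
  obtains L where "holo_on L (ball c r)"
    "\<And>Is i z. set Is \<subseteq> B \<Longrightarrow> length Is = m \<Longrightarrow> z \<in> ball c r \<Longrightarrow>
        partials (i # concat Is) L z = f (mset (i # concat Is)) z"
proof -
  interpret commuting_primitives "holo_functions (ball c r)"
    "\<lambda>i f. cutoff (ball c r) (partial i f)" "\<lambda>i f. cutoff (ball c r) (axis_primitive c i f)"
    by (rule commuting_primitives_ball)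
  obtain L where L: "L \<in> holo_functions (ball c r)"
    "\<And>Is i. set Is \<subseteq> B \<Longrightarrow> length Is = m \<Longrightarrow>
       Ds (i # concat Is) L = cutoff (ball c r) (f (mset (i # concat Is)))"
  proof (rule closed_system_solvable[of B k m "\<lambda>U. cutoff (ball c r) (f U)", OF finite B exchange])
    show "cutoff (ball c r) (f (mset (i # concat Is))) \<in> holo_functions (ball c r)"
      if "set Is \<subseteq> B" "length Is = m" for Is i
      by (intro cutoff_in open_ball holo that)
    show "cutoff (ball c r) (partial j (cutoff (ball c r) (f (mset (i # concat Is))))) =
        cutoff (ball c r) (partial i (cutoff (ball c r) (f (mset (j # concat Is)))))"
      if "set Is \<subseteq> B" "length Is = m" for Is i j
      by (rule cutoff_cong) (simp only: partial_cutoff open_ball closed[OF that])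
  qed blast+
  show ?thesis
  proof (rule that[OF holo_functionsD[OF L(1)]])
    show "partials (i # concat Is) L z = f (mset (i # concat Is)) z"
      if "set Is \<subseteq> B" "length Is = m" "z \<in> ball c r" for Is i z
      using fun_cong[OF L(2)[OF that(1,2), of i], of z] that(3)
      by (simp only: partials_cutoff[OF open_ball] cutoff_apply)
  qed
qed

lemma constant_partials_system_solvable:
  fixes c :: "complex^'n" and B :: "'n list set"
  assumes B: "\<And>I. I \<in> B \<Longrightarrow> length I = k"
    and holo: "\<And>Is. set Is \<subseteq> B \<Longrightarrow> length Is = m \<Longrightarrow> holo_on (f (mset (concat Is))) (ball c r)"
    and const: "\<And>Is j z. set Is \<subseteq> B \<Longrightarrow> length Is = m \<Longrightarrow> z \<in> ball c r \<Longrightarrow>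
          partial j (f (mset (concat Is))) z = 0"
  obtains L where "holo_on L (ball c r)"
    "\<And>Is z. set Is \<subseteq> B \<Longrightarrow> length Is = m \<Longrightarrow> z \<in> ball c r \<Longrightarrow>
        partials (concat Is) L z = f (mset (concat Is)) z"
proof -
  interpret commuting_primitives "holo_functions (ball c r)"
    "\<lambda>i f. cutoff (ball c r) (partial i f)" "\<lambda>i f. cutoff (ball c r) (axis_primitive c i f)"
    by (rule commuting_primitives_ball)
  obtain L where L: "L \<in> holo_functions (ball c r)"
    "\<And>Is. set Is \<subseteq> B \<Longrightarrow> length Is = m \<Longrightarrow>
       Ds (concat Is) L = cutoff (ball c r) (f (mset (concat Is)))"
  proof (rule constant_system_solvable[of B k m "\<lambda>U. cutoff (ball c r) (f U)", OF finite B])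
    show "cutoff (ball c r) (f (mset (concat Is))) \<in> holo_functions (ball c r)"
      if "set Is \<subseteq> B" "length Is = m" for Is
      by (intro cutoff_in open_ball holo that)
    show "cutoff (ball c r) (partial j (cutoff (ball c r) (f (mset (concat Is))))) = 0"
      if "set Is \<subseteq> B" "length Is = m" for Is j
      using const[OF that] by (auto simp: fun_eq_iff cutoff_def[of _ "partial _ _"] partial_cutoff)
  qed blast+
  show ?thesis
  proof (rule that[OF holo_functionsD[OF L(1)]])
    show "partials (concat Is) L z = f (mset (concat Is)) z"
      if "set Is \<subseteq> B" "length Is = m" "z \<in> ball c r" for Is z
      using fun_cong[OF L(2)[OF that(1,2)], of z] that(3)
      by (simp only: partials_cutoff[OF open_ball] cutoff_apply)
  qed
qed

section \<open>Frobenius like structures\<close>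

lemma holo_vf_const: "holo_vf (\<lambda>z. a) W"
  by (simp add: holo_vf_def holo_on_const)

lemma holo_vf_coord: "holo_vf (coord_vf i) W"
  unfolding coord_vf_def by (rule holo_vf_const)

lemma vf_apply_coord: "vf_apply (coord_vf i) f z = partial i f z"
proof -
  have "vf_apply (coord_vf i) f z = (\<Sum>j\<in>UNIV. if j = i then partial j f z else 0)"
    unfolding vf_apply_def coord_vf_def by (intro sum.cong) (auto simp: axis_def)
  then show ?thesis by simp
qed

lemma lie_bracket_coord: "lie_bracket (coord_vf i) (coord_vf j) = (\<lambda>z. 0)"
  unfolding lie_bracket_def vf_apply_coord
  by (simp add: fun_eq_iff vec_eq_iff coord_vf_def partial_def)

lemma sections_subset: "W \<subseteq> U \<Longrightarrow> s \<in> sections E triv U \<Longrightarrow> s \<in> sections E triv W"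
  unfolding sections_def by (auto intro!: holo_on_subset[of _ "_ \<inter> U" "_ \<inter> W"])

text \<open>The elements of \<open>v ` I\<close> needed to span \<open>v a\<close> cannot all lie in \<open>v ` I'\<close>.\<close>
lemma independent_subset_exchange:
  assumes "vector_space scaleV"
    and "independent_subset scaleV V v I" "independent_subset scaleV V v I'" "a \<in> I' - I" "finite I"
  obtains b where "b \<in> I - I'" "independent_subset scaleV V v (insert a (I - {b}))"
proof -
  interpret vector_space scaleV by fact
  note I = assms(2)[unfolded independent_subset_def]
  note I' = assms(3)[unfolded independent_subset_def]
  \<comment> \<open>\<open>X\<close> ranges over the sets between \<open>I \<inter> I'\<close> and
    \<open>I\<close> with \<open>v a\<close> in the span of their vectors. In a minimal one, every
    index outside \<open>I'\<close> is indispensable.\<close>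
  define P where "P X \<longleftrightarrow> I \<inter> I' \<subseteq> X \<and> X \<subseteq> I \<and> v a \<in> span (v ` X)" for X
  have "v a \<in> V" using I' assms(4) span_base[of "v a" "v ` I'"] by auto
  then have "P I" using I by (auto simp: P_def)
  moreover have "finite {X. P X}"
    by (rule finite_subset[of _ "Pow I"]) (use assms(5) in \<open>auto simp: P_def\<close>)
  ultimately obtain X where X: "P X" "\<And>Y. P Y \<Longrightarrow> Y \<subseteq> X \<Longrightarrow> X = Y"
    using finite_has_minimal[of "{X. P X}"] by blast
  have "v a \<notin> span (v ` (I' - {a}))"
  proof -
    have "v ` (I' - {a}) = v ` I' - {v a}"
      using I' assms(4) by (auto simp: inj_on_def)
    then show ?thesis
      using I' assms(4) unfolding dependent_def by auto
  qed
  \<comment> \<open>The indices in \<open>I \<inter> I'\<close> belong to \<open>I' - {a}\<close>,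
    and independence of \<open>I'\<close> keeps \<open>v a\<close> out of the span of their
    vectors.\<close>
  then have "X \<noteq> I \<inter> I'"
    using X(1) assms(4) span_mono[of "v ` (I \<inter> I')" "v ` (I' - {a})"] by (auto simp: P_def)
  with X(1) obtain b where b: "b \<in> X" "b \<in> I - I'" by (auto simp: P_def)
  have "v a \<notin> span (v ` (X - {b}))"
  proof
    assume "v a \<in> span (v ` (X - {b}))"
    then have "P (X - {b})" using X(1) b by (auto simp: P_def)
    with X(2) b(1) show False by blast
  qed
  moreover have "v a \<in> span (insert (v b) (v ` (X - {b})))"
    using X(1) b(1) by (auto simp: P_def insert_absorb image_insert[symmetric] simp del: image_insert)
  \<comment> \<open>Spanning \<open>v a\<close> requires \<open>v b\<close> with a non-zero
    coefficient, so \<open>v b\<close> can be expressed through \<open>v a\<close> and the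
    rest.\<close>
  ultimately have vb: "v b \<in> span (insert (v a) (v ` (X - {b})))"
    by (metis in_span_insert)
  have Ib: "v ` (I - {b}) = v ` I - {v b}"
    using I b(2) by (auto simp: inj_on_def)
  have nb: "v b \<notin> span (v ` (I - {b}))"
    using I b(2) unfolding dependent_def Ib by auto
  \<comment> \<open>Otherwise \<open>vb\<close> would put \<open>v b\<close> into the same span,
    against the independence of \<open>I\<close>.\<close>
  have na: "v a \<notin> span (v ` (I - {b}))"
  proof
    assume "v a \<in> span (v ` (I - {b}))"
    moreover have "v ` (X - {b}) \<subseteq> span (v ` (I - {b}))"
      using X(1) by (auto simp: P_def intro!: span_base)
    ultimately have "span (insert (v a) (v ` (X - {b}))) \<subseteq> span (v ` (I - {b}))"
      by (intro span_minimal) auto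
    with vb nb show False by blast
  qed
  have "independent (insert (v a) (v ` (I - {b})))"
    using na I independent_mono[of "v ` I" "v ` I - {v b}"]
    by (intro independent_insertI) (auto simp: Ib)
  moreover have "inj_on v (insert a (I - {b}))"
    using I na by (auto simp: inj_on_insert intro: inj_on_subset span_base)
  moreover have "span (insert (v a) (v ` (I - {b}))) = V"
  proof -
    have "span (insert (v b) (v ` (I - {b}))) = V"
      using I b(2) by (simp add: Ib insert_absorb)
    moreover have "v b \<in> span (insert (v a) (v ` (I - {b})))"
      using vb span_mono[of "insert (v a) (v ` (X - {b}))" "insert (v a) (v ` (I - {b}))"] X(1) by (auto simp: P_def)
    then have "span (insert (v b) (v ` (I - {b}))) \<subseteq> span (insert (v a) (v ` (I - {b})))"
      by (intro span_minimal) (auto intro: span_base)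
    moreover have "span (insert (v a) (v ` (I - {b}))) \<subseteq> V"
      using \<open>v a \<in> V\<close> I by (metis Ib insert_Diff insert_subset span_minimal span_superset subspace_span Diff_subset image_mono order_trans)
    ultimately show ?thesis by blast
  qed
  ultimately show ?thesis
    using b(2) by (intro that[of b]) (auto simp: independent_subset_def)
qed

section \<open>Independent lists and the zero section\<close>

context frobenius_like_structure
begin

lemma independent_list_exchange:
  assumes "independent_list scaleV V v I" "independent_list scaleV V v I'" "a \<in> set I' - set I"
  shows "\<exists>b\<in>set I - set I'. independent_list scaleV V v (a # remove1 b I)"
proof -
  from independent_subset_exchange[of scaleV V v "set I" "set I'" a] assms V.vector_space_axioms
  obtain b where "b \<in> set I - set I'" "independent_subset scaleV V v (insert a (set I - {b}))"
    unfolding independent_list_def by blast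
  then show ?thesis
    using assms by (intro bexI[of _ b]) (auto simp: independent_list_def set_remove1_eq)
qed

lemma independent_list_length: "independent_list scaleV V v I \<Longrightarrow> length I = k \<and> distinct I"
proof -
  assume I: "independent_list scaleV V v I"
  then have "V.dim V = card (v ` set I)"
    by (intro V.dim_eq_card)
       (auto simp: independent_list_def independent_subset_def V.span_eq_iff[THEN iffD2, OF V_subspace])
  also have "\<dots> = length I"
    using I by (simp add: independent_list_def independent_subset_def card_image distinct_card)
  finally show ?thesis using I V_dim by (simp add: independent_list_def)
qed

lemma zero_section: "(\<lambda>z. 0) \<in> sections E triv U" if "U \<subseteq> M" for U
proof -
  have "holo_on (\<lambda>z. \<phi> z 0 j) (W \<inter> U)" if "(W, r, \<phi>) \<in> triv" for W r \<phi> j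
  proof (rule holo_onI[where a = "\<lambda>_ _. 0"])
    fix z assume "z \<in> W \<inter> U"
    have W: "open W" "W \<subseteq> M" using conn.triv_domain[OF that] by auto
    have *: "\<phi> w 0 j = 0" if "w \<in> W" for w
      using conn.triv_scale[OF \<open>(W, r, \<phi>) \<in> triv\<close> that, of 0 0 j] W(2) that
        conn.subspace_0[OF conn.fibre_subspace] by (auto simp: subset_iff)
    show "((\<lambda>z. \<phi> z 0 j) has_derivative (\<lambda>h. \<Sum>i\<in>UNIV. 0 * h $ i)) (at z)"
      using has_derivative_transform_within_open[OF has_derivative_const[of 0] W(1), of z "\<lambda>z. \<phi> z 0 j"] * \<open>z \<in> W \<inter> U\<close>
      by simp
  qed
  then show ?thesis
    using that conn.subspace_0[OF conn.fibre_subspace] by (auto simp: sections_def subset_iff)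
qed

end

section \<open>Higgs words and the form on them over a fixed open set\<close>

locale frobenius_like_structure_on_open =
  frobenius_like_structure k m M scaleK E triv nabla C S \<zeta> scaleV V v
  for k m and M :: "(complex^'n::finite) set" and scaleK :: "complex \<Rightarrow> 'e::ab_group_add \<Rightarrow> 'e"
    and E triv nabla C S \<zeta> and scaleV :: "complex \<Rightarrow> 'v::ab_group_add \<Rightarrow> 'v" and V v +
  fixes W :: "(complex^'n) set"
  assumes W: "open W" "W \<subseteq> M"
begin

abbreviation Sec :: "(complex^'n \<Rightarrow> 'e) set" where "Sec \<equiv> sections E triv W"
text \<open>Words are arbitrary lists of indices, not only independent ones, and the empty word
  gives \<open>\<zeta>\<close>. This leaves room to move letters between the arguments of the
  form.\<close>

abbreviation higgs_word :: "'n list \<Rightarrow> complex^'n \<Rightarrow> 'e" where "higgs_word w \<equiv> higgs_list C W w \<zeta>"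
abbreviation word_form :: "'n list list \<Rightarrow> complex^'n \<Rightarrow> complex" where
  "word_form ws \<equiv> S W (map higgs_word ws)"

lemma zeta_in: "\<zeta> \<in> Sec"
  by (rule sections_subset[OF W(2) zeta_section])

lemmas higgs_in = higgs.op_section[OF W]

lemmas nabla_in = conn.op_section[OF W]

text \<open>Restriction from \<open>W\<close> to \<open>W\<close> itself expresses that the values
  of sections outside \<open>W\<close> are irrelevant.\<close>

lemma higgs_cong:
  assumes "holo_vf X W" "s \<in> Sec" "t \<in> Sec" "\<And>w. w \<in> W \<Longrightarrow> s w = t w" "z \<in> W"
  shows "C W X s z = C W X t z"
  by (rule higgs.op_restrict[OF W W(1) subset_refl assms(1,1-3) _ _ assms(5)]) (use assms(4) in auto)

lemma nabla_cong:
  assumes "holo_vf X W" "s \<in> Sec" "t \<in> Sec" "\<And>w. w \<in> W \<Longrightarrow> s w = t w" "z \<in> W"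
  shows "nabla W X s z = nabla W X t z"
  by (rule conn.op_restrict[OF W W(1) subset_refl assms(1,1-3) _ _ assms(5)]) (use assms(4) in auto)

lemma form_cong:
  assumes "length ss = m" "length ss' = m" "set ss \<subseteq> Sec" "set ss' \<subseteq> Sec"
    and "\<And>j w. j < m \<Longrightarrow> w \<in> W \<Longrightarrow> (ss ! j) w = (ss' ! j) w" "z \<in> W"
  shows "S W ss z = S W ss' z"
  by (rule form.form_restrict[OF W W(1) subset_refl assms(1-4) _ assms(6)]) (use assms(5) in auto)

lemma higgs_list_in: "s \<in> Sec \<Longrightarrow> higgs_list C W w s \<in> Sec"
  by (induction w) (auto simp: higgs_list_def intro: higgs_in holo_vf_coord)

lemma higgs_list_Cons: "higgs_list C W (x # w) s = C W (coord_vf x) (higgs_list C W w s)"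
  by (simp add: higgs_list_def)

lemma higgs_list_remove1:
  assumes "s \<in> Sec" "x \<in> set w" "z \<in> W"
  shows "higgs_list C W w s z = higgs_list C W (x # remove1 x w) s z"
  using assms(2,3)
proof (induction w arbitrary: z)
  case (Cons y w)
  show ?case
  proof (cases "x = y")
    case False
    then have "higgs_list C W (y # w) s z = C W (coord_vf y) (higgs_list C W (x # remove1 x w) s) z"
      unfolding higgs_list_Cons[of y] using Cons assms(1)
      by (intro higgs_cong holo_vf_coord higgs_list_in) auto
    also have "\<dots> = C W (coord_vf x) (higgs_list C W (y # remove1 x w) s) z"
      unfolding higgs_list_Cons
      by (rule higgs.higgs_commute[OF W holo_vf_coord holo_vf_coord higgs_list_in[OF assms(1)] Cons.prems(2)])
    finally show ?thesis using False by (simp add: higgs_list_Cons)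
  qed simp
qed simp

lemma higgs_list_mset_cong:
  assumes "s \<in> Sec" "mset w = mset w'" "z \<in> W"
  shows "higgs_list C W w s z = higgs_list C W w' s z"
  using assms(2,3)
proof (induction w arbitrary: w' z)
  case (Cons x w)
  then have x: "x \<in> set w'" by (metis list.set_intros(1) set_mset_mset)
  have "mset w = mset (remove1 x w')"
    using Cons.prems(1) by (metis add_mset_remove_trivial mset.simps(2) mset_remove1)
  from Cons.IH[OF this] have "higgs_list C W (x # w) s z = higgs_list C W (x # remove1 x w') s z"
    unfolding higgs_list_Cons using Cons.prems(2) assms(1)
    by (intro higgs_cong holo_vf_coord higgs_list_in)
  also have "\<dots> = higgs_list C W w' s z"
    using higgs_list_remove1[OF assms(1) x Cons.prems(2)] by simp
  finally show ?case .
qed simp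

text \<open>Flatness is given for words formed over \<open>M\<close>, while the potentials refer to
  words over \<open>W\<close>; compatibility with restriction, letter by letter, joins the
  two.\<close>

lemma higgs_list_restrict:
  assumes "z \<in> W"
  shows "higgs_list C M w \<zeta> z = higgs_word w z"
  using assms
proof (induction w arbitrary: z)
  case (Cons x w)
  have "higgs_list C M w \<zeta> \<in> sections E triv M"
    by (induction w) (auto simp: higgs_list_def zeta_section intro: higgs.op_section conn.open_base holo_vf_coord)
  then show ?case
    unfolding higgs_list_def foldr.simps o_def
    using higgs.op_restrict[OF conn.open_base subset_refl W holo_vf_coord holo_vf_coord _ higgs_list_in[OF zeta_in] _ _ Cons.prems]
      Cons.IH by (simp add: higgs_list_def)
qed (simp add: higgs_list_def)

lemma higgs_word_flat:
  assumes "independent_list scaleV V v I" "holo_vf X W" "z \<in> W"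
  shows "nabla W X (higgs_word I) z = 0"
proof -
  have M: "higgs_list C M I \<zeta> \<in> sections E triv M"
    by (induction I) (auto simp: higgs_list_def zeta_section intro: higgs.op_section conn.open_base holo_vf_coord)
  have "nabla W X (higgs_list C M I \<zeta>) z = 0"
    using higgs_zeta_flat[OF assms(1)] W assms(2,3) unfolding flat_section_def by blast
  then show ?thesis
    using nabla_cong[OF assms(2) sections_subset[OF W(2) M] higgs_list_in[OF zeta_in] higgs_list_restrict assms(3)]
    by simp
qed

lemma word_form_holo: "length ws = m \<Longrightarrow> holo_on (word_form ws) W"
  by (rule form.form_holo[OF W]) (auto intro: higgs_list_in zeta_in)

text \<open>Higgs field invariance carries the leading letter of any slot to the first slot.
  Repeating this empties the other slots, and commutation of the Higgs endomorphisms sorts the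
  letters collected.\<close>

lemma word_form_collect:
  assumes "Suc (length ws) = m" "z \<in> W"
  shows "word_form (w # ws) z = word_form ((w @ concat ws) # replicate (length ws) []) z"
  using assms(1)
proof (induction "length (concat ws)" arbitrary: w ws rule: less_induct)
  case less
  show ?case
  proof (cases "concat ws = []")
    case True
    then have *: "ws = replicate (length ws) []"
      by (intro replicate_eqI) auto
    show ?thesis unfolding True append_Nil2 *[symmetric] ..
  next
    case False
    then obtain l where l: "l < length ws" "ws ! l \<noteq> []"
      by (auto simp: in_set_conv_nth)
    then obtain x u where xu: "ws ! l = x # u" by (cases "ws ! l") auto
    define us where "us = ws[l := u]"
    have "ws = take l ws @ (x # u) # drop (Suc l) ws"
      using l(1) xu by (metis id_take_nth_drop)
    moreover have us: "us = take l ws @ u # drop (Suc l) ws"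
      using l(1) by (simp add: us_def upd_conv_take_nth_drop)
    ultimately have "concat ws = concat (take l ws) @ (x # u) @ concat (drop (Suc l) ws)"
      "concat us = concat (take l ws) @ u @ concat (drop (Suc l) ws)"
      by (metis concat.simps(2) concat_append)+
    then have c: "mset (concat ws) = add_mset x (mset (concat us))"
      "length (concat us) < length (concat ws)" by simp_all
    \<comment> \<open>The arguments with the letter \<open>x\<close> taken out. Invariance compares
      its insertion at \<open>Suc l\<close>, shifted by one because \<open>w\<close> occupies slot
      0, with its insertion at 0.\<close>
    let ?ss = "map higgs_word (w # us)"
    have "?ss[Suc l := C W (coord_vf x) (?ss ! Suc l)] = map higgs_word (w # us[l := x # u])"
      using l(1) by (simp add: map_update us_def higgs_list_Cons)
    also have "us[l := x # u] = ws"
      by (simp add: us_def flip: xu)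
    finally have "?ss[Suc l := C W (coord_vf x) (?ss ! Suc l)] = map higgs_word (w # ws)" .
    then have "word_form (w # ws) z = S W (?ss[Suc l := C W (coord_vf x) (?ss ! Suc l)]) z"
      by simp
    also have "\<dots> = S W (?ss[0 := C W (coord_vf x) (?ss ! 0)]) z"
      using less.prems l(1)
      by (intro form_higgs_invariant W holo_vf_coord assms(2)) (auto simp: us_def intro: higgs_list_in zeta_in)
    also have "?ss[0 := C W (coord_vf x) (?ss ! 0)] = map higgs_word ((x # w) # us)"
      by (simp add: higgs_list_Cons)
    also have "word_form ((x # w) # us) z = word_form (((x # w) @ concat us) # replicate (length us) []) z"
      using c(2) less.prems by (intro less.hyps) (auto simp: us_def)
    also have "\<dots> = word_form ((w @ concat ws) # replicate (length ws) []) z"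
    proof (rule form_cong)
      fix j y assume j: "j < m" and y: "y \<in> W"
      show "(map higgs_word (((x # w) @ concat us) # replicate (length us) []) ! j) y =
        (map higgs_word ((w @ concat ws) # replicate (length ws) []) ! j) y"
      proof (cases j)
        case 0
        have "mset ((x # w) @ concat us) = mset (w @ concat ws)" by (simp add: c)
        from higgs_list_mset_cong[OF zeta_in this y] show ?thesis by (simp add: 0)
      qed (simp add: us_def)
    qed (use less.prems assms(2) in \<open>auto simp: us_def intro!: higgs_list_in zeta_in\<close>)
    finally show ?thesis .
  qed
qed

lemma word_form_mset_cong:
  assumes "length ws = m" "length ws' = m" "mset (concat ws) = mset (concat ws')" "z \<in> W"
  shows "word_form ws z = word_form ws' z"
proof -
  obtain w us w' us' where ws: "ws = w # us" "ws' = w' # us'"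
    using assms(1,2) m_pos by (cases ws; cases ws') auto
  have "word_form ((w @ concat us) # replicate (length us) []) z = word_form ((w' @ concat us') # replicate (length us') []) z"
  proof (rule form_cong)
    fix j y assume j: "j < m" and y: "y \<in> W"
    have "mset (w @ concat us) = mset (w' @ concat us')" using assms(3) ws by simp
    from higgs_list_mset_cong[OF zeta_in this y]
    show "(map higgs_word ((w @ concat us) # replicate (length us) []) ! j) y =
        (map higgs_word ((w' @ concat us') # replicate (length us') []) ! j) y"
      using assms(1,2) j by (cases j) (auto simp: ws)
  qed (use assms ws in \<open>auto intro!: higgs_list_in zeta_in\<close>)
  then show ?thesis
    using word_form_collect[of us z w] word_form_collect[of us' z w'] assms ws by simp
qed

text \<open>The solvability results take data indexed by multisets. Some enumeration of
  \<open>U\<close> fills the first slot and \<open>\<zeta>\<close> the others; by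
  \<open>word_form_mset_cong\<close> the choice has no effect on \<open>W\<close>.\<close>

definition multiset_form :: "'n multiset \<Rightarrow> complex^'n \<Rightarrow> complex" where
  "multiset_form U = word_form ((SOME w. mset w = U) # replicate (m - 1) [])"

lemma multiset_form_eq:
  assumes "length ws = m" "z \<in> W"
  shows "multiset_form (mset (concat ws)) z = word_form ws z"
proof -
  have "mset (SOME w. mset w = mset (concat ws)) = mset (concat ws)"
    by (rule someI[of _ "concat ws"]) simp
  then show ?thesis
    unfolding multiset_form_def using assms m_pos by (intro word_form_mset_cong) auto
qed

section \<open>Derivatives of the form on Higgs words\<close>

text \<open>On \<open>W\<close> the section \<open>t\<close> coincides with its multiple by the
  constant 0, to which linearity applies; outside \<open>W\<close> it may be non-zero.\<close>

lemma form_zero: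
  assumes "length ss = m" "set ss \<subseteq> Sec" "j < m" "t \<in> Sec" "\<And>w. w \<in> W \<Longrightarrow> t w = 0" "z \<in> W"
  shows "S W (ss[j := t]) z = 0"
proof -
  have "S W (ss[j := t]) z = S W (ss[j := (\<lambda>w. scaleK 0 (t w))]) z"
    using assms zero_section[OF W(2)] set_update_subset_insert[of ss j]
    by (intro form_cong) (auto simp: nth_list_update subset_iff dest!: set_update_subset_insert[THEN subsetD])
  also have "\<dots> = 0 * S W (ss[j := t]) z"
    by (rule form.form_scale[OF W assms(1-3) holo_on_const assms(4,6)])
  finally show ?thesis by simp
qed

lemma higgs_zero:
  assumes "holo_vf X W" "t \<in> Sec" "\<And>w. w \<in> W \<Longrightarrow> t w = 0" "z \<in> W"
  shows "C W X t z = 0"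
proof -
  have "C W X t z = C W X (\<lambda>w. scaleK 0 (t w)) z"
    using assms zero_section[OF W(2)] by (intro higgs_cong) auto
  also have "\<dots> = scaleK 0 (C W X t z)"
    by (rule higgs.higgs_scale[OF W assms(1) holo_on_const assms(2,4)])
  finally show ?thesis by simp
qed

text \<open>The zero field is 0 times an arbitrary coordinate field. It arises as the Lie bracket of
  two coordinate fields.\<close>

lemma higgs_zero_vf:
  assumes "s \<in> Sec" "z \<in> W"
  shows "C W (\<lambda>w. 0) s z = 0"
  using higgs.op_vf_scale[OF W holo_on_const holo_vf_coord assms, of 0 undefined] by simp

text \<open>In the vanishing 2-form applied to coordinate fields and \<open>s\<close>, flatness of
  \<open>s\<close> removes the terms with the Higgs field outside the connection, and the bracket
  term is zero. The two terms that remain are equal.\<close>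

lemma nabla_higgs_symmetric:
  assumes s: "s \<in> Sec" and flat: "\<And>X z. holo_vf X W \<Longrightarrow> z \<in> W \<Longrightarrow> nabla W X s z = 0" and z: "z \<in> W"
  shows "nabla W (coord_vf j) (C W (coord_vf i) s) z = nabla W (coord_vf i) (C W (coord_vf j) s) z"
proof -
  have 0: "C W (coord_vf a) (nabla W (coord_vf b) s) z = 0" for a b
    by (intro higgs_zero holo_vf_coord nabla_in s flat z)
  have "nabla_higgs nabla C W (coord_vf j) (coord_vf i) s z = 0"
    by (rule higgs_potential[OF W holo_vf_coord holo_vf_coord s z])
  then show ?thesis
    by (simp add: nabla_higgs_def end_deriv_def 0 lie_bracket_coord higgs_zero_vf[OF s z])
qed

lemma partial_form:
  assumes "length ss = m" "set ss \<subseteq> Sec" "z \<in> W"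
  shows "partial i (S W ss) z = (\<Sum>j<m. S W (ss[j := nabla W (coord_vf i) (ss ! j)]) z)"
  using form_flat[OF W holo_vf_coord assms] by (simp add: vf_apply_coord)

lemma form_nabla_flat:
  assumes "length ss = m" "set ss \<subseteq> Sec" "z \<in> W" "j < m" "ss ! j = higgs_word I"
    "independent_list scaleV V v I"
  shows "S W (ss[j := nabla W (coord_vf i) (ss ! j)]) z = 0"
  unfolding assms(5)
  by (intro form_zero assms nabla_in holo_vf_coord higgs_list_in zeta_in higgs_word_flat)

text \<open>By flatness of the form, each summand of the derivative contains the derivative of a
  flat argument. The data for the first potential are therefore constant on balls.\<close>

lemma partial_word_form_flat:
  assumes "length Is = m" "\<And>I. I \<in> set Is \<Longrightarrow> independent_list scaleV V v I" "z \<in> W"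
  shows "partial i (word_form Is) z = 0"
proof -
  have "S W ((map higgs_word Is)[j := nabla W (coord_vf i) (map higgs_word Is ! j)]) z = 0" if "j < m" for j
    using assms that
    by (intro form_nabla_flat[where I = "Is ! j"]) (auto intro!: higgs_list_in zeta_in)
  then show ?thesis
    using assms by (subst partial_form) (auto intro!: higgs_list_in zeta_in sum.neutral)
qed

text \<open>This is the closedness of the data for the second potential: only the argument carrying
  the extra index contributes, and there \<open>nabla_higgs_symmetric\<close> applies.\<close>

lemma partial_word_form_symmetric:
  assumes "Suc (length Is) = m" "\<And>J. J \<in> set (I # Is) \<Longrightarrow> independent_list scaleV V v J" "z \<in> W"
  shows "partial j (word_form ((i # I) # Is)) z = partial i (word_form ((j # I) # Is)) z"
proof -
  have *: "partial j (word_form ((i # I) # Is)) z =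
      S W (nabla W (coord_vf j) (C W (coord_vf i) (higgs_word I)) # map higgs_word Is) z" for i j
  proof -
    let ?ss = "map higgs_word ((i # I) # Is)"
    have "partial j (S W ?ss) z = (\<Sum>l<m. S W (?ss[l := nabla W (coord_vf j) (?ss ! l)]) z)"
      using assms by (intro partial_form) (auto intro: higgs_list_in zeta_in)
    \<comment> \<open>Every slot after the first holds a flat section, so its summand
      vanishes.\<close>
    also have "\<dots> = (\<Sum>l<m. if l = 0 then S W (?ss[0 := nabla W (coord_vf j) (?ss ! 0)]) z else 0)"
    proof (intro sum.cong refl)
      fix l assume l: "l \<in> {..<m}"
      show "S W (?ss[l := nabla W (coord_vf j) (?ss ! l)]) z =
          (if l = 0 then S W (?ss[0 := nabla W (coord_vf j) (?ss ! 0)]) z else 0)"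
      proof (cases l)
        case (Suc p)
        then have "S W (?ss[l := nabla W (coord_vf j) (?ss ! l)]) z = 0"
          using assms l by (intro form_nabla_flat[where I = "Is ! p"]) (auto intro: higgs_list_in zeta_in)
        with Suc show ?thesis by simp
      qed simp
    qed
    also have "\<dots> = S W (?ss[0 := nabla W (coord_vf j) (?ss ! 0)]) z"
      using m_pos by simp
    finally show ?thesis by (simp add: higgs_list_Cons)
  qed
  show ?thesis
    unfolding *
  proof (rule form_cong)
    fix l w assume "w \<in> W"
    then show "((nabla W (coord_vf j) (C W (coord_vf i) (higgs_word I)) # map higgs_word Is) ! l) w =
        ((nabla W (coord_vf i) (C W (coord_vf j) (higgs_word I)) # map higgs_word Is) ! l) w"
      using assms(2)[of I] by (cases l) (auto intro!: nabla_higgs_symmetric higgs_list_in zeta_in higgs_word_flat)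
  qed (use assms in \<open>auto intro!: nabla_in higgs_in holo_vf_coord higgs_list_in zeta_in\<close>)
qed

end

section \<open>Both potentials on a ball around a given point\<close>

theorem theorem1p2:
  fixes k m :: nat
    and M :: "(complex^'n::finite) set"
    and scaleK :: "complex \<Rightarrow> 'e::ab_group_add \<Rightarrow> 'e"
    and E :: "complex^'n \<Rightarrow> 'e set"
    and triv :: "('n, 'e) local_triv set"
    and nabla C :: "('n, 'e) section_op"
    and S :: "(complex^'n) set \<Rightarrow> (complex^'n \<Rightarrow> 'e) list \<Rightarrow> complex^'n \<Rightarrow> complex"
    and \<zeta> :: "complex^'n \<Rightarrow> 'e"
    and scaleV :: "complex \<Rightarrow> 'v::ab_group_add \<Rightarrow> 'v"
    and V :: "'v set"
    and v :: "'n \<Rightarrow> 'v"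
  assumes "frobenius_like_structure k m M scaleK E triv nabla C S \<zeta> scaleV V v"
  shows "\<forall>z\<in>M. \<exists>W. open W \<and> z \<in> W \<and> W \<subseteq> M \<and>
           (\<exists>Q. potential_first_kind m C S \<zeta> scaleV V v W Q) \<and>
           (\<exists>L. potential_second_kind m C S \<zeta> scaleV V v W L)"
proof
  fix z assume "z \<in> M"
  interpret frobenius_like_structure k m M scaleK E triv nabla C S \<zeta> scaleV V v by fact
  from conn.open_base \<open>z \<in> M\<close> obtain r where r: "r > 0" "ball z r \<subseteq> M"
    using open_contains_ball by blast
  interpret frobenius_like_structure_on_open k m M scaleK E triv nabla C S \<zeta> scaleV V v "ball z r"
    by unfold_locales (use r in auto)
  define B where "B = {I. independent_list scaleV V v I}"
  have B: "length I = k \<and> distinct I" if "I \<in> B" for I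
    using that by (simp add: B_def independent_list_length)
  \<comment> \<open>On the ball the multiset data may be computed with any splitting into
    \<open>m\<close> words, and so may their partial derivatives.\<close>
  have form_agree: "holo_on (multiset_form (mset (concat ws))) (ball z r)"
      "w \<in> ball z r \<Longrightarrow> partial j (multiset_form (mset (concat ws))) w = partial j (word_form ws) w"
    if "length ws = m" for ws j w
  proof -
    show "holo_on (multiset_form (mset (concat ws))) (ball z r)"
      by (rule holo_on_cong[OF open_ball _ word_form_holo[OF that]]) (simp add: multiset_form_eq[OF that] del: mem_ball)
    show "partial j (multiset_form (mset (concat ws))) w = partial j (word_form ws) w" if "w \<in> ball z r"
      by (rule partial_cong[OF open_ball that multiset_form_eq[OF \<open>length ws = m\<close>]])
  qed
  obtain Q where Q: "holo_on Q (ball z r)"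
    "\<And>Is w. set Is \<subseteq> B \<Longrightarrow> length Is = m \<Longrightarrow> w \<in> ball z r \<Longrightarrow>
        partials (concat Is) Q w = multiset_form (mset (concat Is)) w"
  proof (rule constant_partials_system_solvable[of B k m multiset_form z r])
    show "partial j (multiset_form (mset (concat Is))) w = 0"
      if "set Is \<subseteq> B" "length Is = m" "w \<in> ball z r" for Is j w
      using that partial_word_form_flat[of Is w j] form_agree(2)[of Is w j] by (auto simp: B_def)
  qed (use B form_agree(1) in blast)+
  have "potential_first_kind m C S \<zeta> scaleV V v (ball z r) Q"
    unfolding potential_first_kind_def
  proof (intro conjI allI impI ballI Q(1))
    fix Is w assume Is: "length Is = m \<and> (\<forall>I\<in>set Is. independent_list scaleV V v I)" and w: "w \<in> ball z r"
    then show "partials (concat Is) Q w = word_form Is w"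
      using Q(2)[of Is w] multiset_form_eq[of Is w] by (auto simp: B_def)
  qed
  moreover
  have split: "\<exists>I Js. Is = I # Js \<and> Suc (length Js) = m" if "length Is = m" for Is :: "'n list list"
    using that m_pos by (cases Is) auto
  obtain L where L: "holo_on L (ball z r)"
    "\<And>Is i w. set Is \<subseteq> B \<Longrightarrow> length Is = m \<Longrightarrow> w \<in> ball z r \<Longrightarrow>
        partials (i # concat Is) L w = multiset_form (mset (i # concat Is)) w"
  proof (rule closed_partials_system_solvable[of B k m multiset_form z r])
    show "\<exists>b\<in>set I - set I'. a # remove1 b I \<in> B" if "I \<in> B" "I' \<in> B" "a \<in> set I' - set I" for I I' a
      using independent_list_exchange[of I I' a] that by (simp add: B_def)
    show "holo_on (multiset_form (mset (i # concat Is))) (ball z r)" if "length Is = m" for Is i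
    proof -
      \<comment> \<open>The extra index is absorbed into the first word:
        \<open>i # concat Is\<close> is the concatenation of the \<open>m\<close> words
        \<open>(i # I) # Js\<close>.\<close>
      from split[OF that] obtain I Js where Is: "Is = I # Js" "Suc (length Js) = m" by blast
      with form_agree(1)[of "(i # I) # Js"] show ?thesis by simp
    qed
    show "partial j (multiset_form (mset (i # concat Is))) w = partial i (multiset_form (mset (j # concat Is))) w"
      if "set Is \<subseteq> B" "length Is = m" "w \<in> ball z r" for Is i j w
    proof -
      from split[OF that(2)] obtain I Js where Is: "Is = I # Js" "Suc (length Js) = m" by blast
      have "partial j (word_form ((i # I) # Js)) w = partial i (word_form ((j # I) # Js)) w"
        by (rule partial_word_form_symmetric[OF Is(2) _ that(3)]) (use that(1) Is in \<open>auto simp: B_def\<close>)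
      then show ?thesis
        using form_agree(2)[of "(i # I) # Js" w j] form_agree(2)[of "(j # I) # Js" w i] Is that(3) by simp
    qed
  qed (use B in blast)+
  have "potential_second_kind m C S \<zeta> scaleV V v (ball z r) L"
    unfolding potential_second_kind_def
  proof (intro conjI allI impI ballI L(1))
    fix i I Is w assume Is: "length (I # Is) = m \<and> (\<forall>I'\<in>set (I # Is). independent_list scaleV V v I')"
      and w: "w \<in> ball z r"
    then have "partials (i # concat (I # Is)) L w = word_form ((i # I) # Is) w"
      using L(2)[of "I # Is" w i] multiset_form_eq[of "(i # I) # Is" w] by (auto simp: B_def)
    then show "partials (i # concat (I # Is)) L w =
        S (ball z r) (C (ball z r) (coord_vf i) (higgs_word I) # map higgs_word Is) w"
      by (simp only: list.map higgs_list_Cons)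
  qed
  ultimately show "\<exists>W. open W \<and> z \<in> W \<and> W \<subseteq> M \<and>
           (\<exists>Q. potential_first_kind m C S \<zeta> scaleV V v W Q) \<and>
           (\<exists>L. potential_second_kind m C S \<zeta> scaleV V v W L)"
    using r by (intro exI[of _ "ball z r"]) auto
qed

end
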